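(* Let $T \subset \mathbb{R}^2$ be an equilateral triangle with side length $1/2$. Let $\mathcal{F}$ be the family of seven unit disks in $\mathbb{R}^2$ whose centers are the three vertices of $T$, the three midpoints of the sides of $T$, and the center (centroid) of $T$. Then the area $\mathrm{OA}(\mathcal{F})$ of the set of points of $\mathbb{R}^2$ that are contained in an odd number of the seven disks satisfies $$\mathrm{OA}(\mathcal{F}) \leq 3.12.$$
   Context: A unit disk is a disk of radius $1$ in the Euclidean plane, i.e. $\{x \in \mathbb{R}^2 : \|x - c\| \leq 1\}$ for a center $c \in \mathbb{R}^2$. For a finite family $\mathcal{F}$ of unit disks in $\mathbb{R}^2$, the odd area $\mathrm{OA}(\mathcal{F})$ is the area (two-dimensional Lebesgue measure) of the set of points $x \in \mathbb{R}^2$ for which the number of disks in $\mathcal{F}$ containing $x$ is odd. *)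

theory Defs
  imports "HOL-Analysis.Analysis" "HOL-Library.Multiset"
begin

definition unit_disk :: "real^2 \<Rightarrow> (real^2) set" where
  "unit_disk c = cball c 1"

(* A finite family is a multiset, so a repeated disk is counted with its multiplicity.
   For a finite family of unit disks the set below is bounded and Borel, so measure
   is its true, finite area. *)
definition odd_area :: "(real^2) set multiset \<Rightarrow> real" where
  "odd_area F = measure lebesgue {x. odd (size {# D \<in># F. x \<in> D #})}"

definition equilateral_triangle :: "real \<Rightarrow> real^2 \<Rightarrow> real^2 \<Rightarrow> real^2 \<Rightarrow> bool" where
  "equilateral_triangle s a b c \<longleftrightarrow> s > 0 \<and> dist a b = s \<and> dist b c = s \<and> dist c a = s"

definition centroid :: "real^2 \<Rightarrow> real^2 \<Rightarrow> real^2 \<Rightarrow> real^2" where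
  "centroid a b c = (1 / 3) *\<^sub>R (a + b + c)"

definition seven_centers :: "real^2 \<Rightarrow> real^2 \<Rightarrow> real^2 \<Rightarrow> (real^2) multiset" where
  "seven_centers a b c =
     {# a, b, c, midpoint a b, midpoint b c, midpoint c a, centroid a b c #}"

end

theory Submission
  imports Defs
begin

text \<open>
Every centre is at distance less than \<open>1 / 2\<close> from the centroid \<open>m\<close> of the triangle, so every disk contains
\<open>m\<close> and meets each ray from \<open>m\<close> in a segment. In polar coordinates around \<open>m\<close> the area of a disk in an
angular sector is half the integral of the squared exit distance, and this integral has an elementary
antiderivative (\<open>DERIV_swept\<close>, \<open>sector_measure\<close>).

The perpendicular bisectors of the three sides cut the plane into six sectors of 60 degrees, one for
each order of the distances to the vertices. They are alike, so it is enough to show that the odd set has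
area at most
\<open>3.12 / 6 = 0.52\<close> in one of them (\<open>odd_sextant\<close>).

On a single ray the seven segments are nested. Listing the exit distances in increasing order, the odd
set consists of the first segment and of the gaps between the second and the third, the fourth and the
fifth, the sixth and the seventh distance. Thus it is the symmetric difference of one disk and three
pairs of disks, and for an upper bound any pairing may be used on any part of the sector, since the area
of a symmetric difference is subadditive (\<open>sextant_cover\<close>). With a good pairing, changed once inside the
sector, everything reduces to areas of symmetric differences of two disks in a sector. Such an area is
determined by the antiderivatives at the ends of the sector and at the direction in which the two
circles cross. At the crossing their difference is the area of a lune plus a cross product of the centres
(\<open>crossing\<close>), so that no crossing angle has to be computed. What remains is an explicit sum of values of
\<open>s sqrt (1 - s\<^sup>2) + arcsin s\<close>, estimated by polynomials close to its Taylor
expansion \<open>2 s - s ^ 3 / 3 - s ^ 5 / 20 - ...\<close> (\<open>numeric_bound\<close>).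

The odd area is in fact about \<open>3.108\<close>, so the pairing and the polynomials must be accurate to
about 0.3 per cent.
\<close>

section \<open>Rays from a point inside a unit disk\<close>

text \<open>For a centre \<open>p\<close>, \<open>along p\<close> and \<open>across p\<close> are its components parallel to the ray in direction
\<open>\<theta>\<close> and (up to sign) orthogonal to it, \<open>reach p \<theta>\<close> is the distance at which that ray leaves the unit
disk around \<open>p\<close>, and \<open>tilt p \<theta>\<close> is the direction in which the exit point is seen from \<open>p\<close>. The
function \<open>swept p\<close> is an antiderivative of \<open>(reach p)\<^sup>2\<close>: its increments are twice the area that the ray
sweeps inside the disk, and its two summands are twice the circular sector at \<open>p\<close> and twice the
triangles that lead from \<open>p\<close> back to the origin.\<close>

definition along :: "complex \<Rightarrow> real \<Rightarrow> real" where
  "along p \<theta> = Re p * cos \<theta> + Im p * sin \<theta>"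

definition across :: "complex \<Rightarrow> real \<Rightarrow> real" where
  "across p \<theta> = Re p * sin \<theta> - Im p * cos \<theta>"

definition reach :: "complex \<Rightarrow> real \<Rightarrow> real" where
  "reach p \<theta> = along p \<theta> + sqrt (1 - (across p \<theta>)\<^sup>2)"

definition tilt :: "complex \<Rightarrow> real \<Rightarrow> real" where
  "tilt p \<theta> = \<theta> + arcsin (across p \<theta>)"

definition swept :: "complex \<Rightarrow> real \<Rightarrow> real" where
  "swept p \<theta> = tilt p \<theta> + across p \<theta> * reach p \<theta>"

lemma along_across: "(along p \<theta>)\<^sup>2 + (across p \<theta>)\<^sup>2 = (cmod p)\<^sup>2"
proof -
  have "(along p \<theta>)\<^sup>2 + (across p \<theta>)\<^sup>2 =
      ((Re p)\<^sup>2 + (Im p)\<^sup>2) * ((sin \<theta>)\<^sup>2 + (cos \<theta>)\<^sup>2)"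
    unfolding along_def across_def by algebra
  thus ?thesis by (simp add: cmod_power2)
qed

lemma across_le: "\<bar>across p \<theta>\<bar> \<le> cmod p"
  using along_across[of p \<theta>] by (metis abs_le_square_iff abs_norm_cancel le_add_same_cancel2 zero_le_power2)

lemma rcis_dist2: "(cmod (rcis r \<theta> - p))\<^sup>2 = (r - along p \<theta>)\<^sup>2 + (across p \<theta>)\<^sup>2"
proof -
  have "(cmod (rcis r \<theta> - p))\<^sup>2 = (r * cos \<theta> - Re p)\<^sup>2 + (r * sin \<theta> - Im p)\<^sup>2"
    by (simp add: cmod_power2)
  also have "\<dots> = r\<^sup>2 * ((sin \<theta>)\<^sup>2 + (cos \<theta>)\<^sup>2) - 2 * r * along p \<theta> + (cmod p)\<^sup>2"
    unfolding along_def cmod_power2 by algebra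
  finally show ?thesis
    using along_across[of p \<theta>] by (simp add: power2_diff)
qed

lemma rcis_in_disk_iff:
  assumes "cmod p < 1/2" "0 \<le> r"
  shows "cmod (rcis r \<theta> - p) \<le> 1 \<longleftrightarrow> r \<le> reach p \<theta>"
proof -
  define s where "s = sqrt (1 - (across p \<theta>)\<^sup>2)"
  have "\<bar>across p \<theta>\<bar> < 1" using across_le[of p \<theta>] assms by linarith
  hence a: "(across p \<theta>)\<^sup>2 < 1" by (simp add: abs_square_less_1)
  hence s: "s\<^sup>2 = 1 - (across p \<theta>)\<^sup>2" "0 \<le> s" by (auto simp: s_def)
  have "cmod (rcis r \<theta> - p) \<le> 1 \<longleftrightarrow> (cmod (rcis r \<theta> - p))\<^sup>2 \<le> 1"
    by (simp add: power_le_one_iff abs_square_le_1)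
  also have "\<dots> \<longleftrightarrow> (r - along p \<theta>)\<^sup>2 \<le> s\<^sup>2" unfolding rcis_dist2 s(1) by linarith
  also have "\<dots> \<longleftrightarrow> \<bar>r - along p \<theta>\<bar> \<le> s" using s(2) by (metis abs_le_square_iff abs_of_nonneg)
  also have "\<dots> \<longleftrightarrow> r \<le> reach p \<theta>"
  proof -
    have "(along p \<theta>)\<^sup>2 \<le> s\<^sup>2"
    proof -
      have "(cmod p)\<^sup>2 \<le> 1\<^sup>2" using assms by (intro power_mono) auto
      thus ?thesis using along_across[of p \<theta>] s(1) by simp
    qed
    hence "\<bar>along p \<theta>\<bar> \<le> s" using s(2) by (metis abs_le_square_iff abs_of_nonneg)
    thus ?thesis using assms(2) unfolding reach_def s_def[symmetric] by linarith
  qed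
  finally show ?thesis .
qed

lemma reach_ge: "1 - cmod p \<le> reach p \<theta>" if "cmod p < 1/2"
proof -
  have "cmod (rcis (1 - cmod p) \<theta> - p) \<le> cmod (rcis (1 - cmod p) \<theta>) + cmod p"
    by (rule norm_triangle_ineq4)
  also have "\<dots> = 1" using that by simp
  finally show ?thesis using rcis_in_disk_iff[OF that, of "1 - cmod p" \<theta>] that by simp
qed

lemma reach_pos: "0 < reach p \<theta>" if "cmod p < 1/2"
  using reach_ge[OF that, of \<theta>] that by simp

lemma across_lt_1: "\<bar>across p \<theta>\<bar> < 1" "(across p \<theta>)\<^sup>2 < 1" if "cmod p < 1/2"
proof -
  show "\<bar>across p \<theta>\<bar> < 1" using across_le[of p \<theta>] that by linarith
  thus "(across p \<theta>)\<^sup>2 < 1" by (simp add: abs_square_less_1)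
qed

lemma DERIV_along: "(along p has_real_derivative - across p \<theta>) (at \<theta>)"
  unfolding along_def[abs_def] across_def by (auto intro!: derivative_eq_intros)

lemma DERIV_across: "(across p has_real_derivative along p \<theta>) (at \<theta>)"
  unfolding along_def across_def[abs_def] by (auto intro!: derivative_eq_intros)

lemma DERIV_tilt:
  assumes "cmod p < 1/2"
  shows "(tilt p has_real_derivative reach p \<theta> / sqrt (1 - (across p \<theta>)\<^sup>2)) (at \<theta>)"
proof -
  have [simp]: "sqrt (1 - (across p \<theta>)\<^sup>2) \<noteq> 0" using across_lt_1[OF assms, of \<theta>] by auto
  show ?thesis
    unfolding tilt_def[abs_def] reach_def
    using across_lt_1[OF assms, of \<theta>]
    by (auto intro!: derivative_eq_intros DERIV_across simp: divide_simps)
qed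

lemma DERIV_reach:
  assumes "cmod p < 1/2"
  shows "(reach p has_real_derivative
    - across p \<theta> * reach p \<theta> / sqrt (1 - (across p \<theta>)\<^sup>2)) (at \<theta>)"
proof -
  have [simp]: "sqrt (1 - (across p \<theta>)\<^sup>2) \<noteq> 0" using across_lt_1[OF assms, of \<theta>] by auto
  have *: "((\<lambda>\<theta>. sqrt (1 - (across p \<theta>)\<^sup>2)) has_real_derivative
      - (across p \<theta> * along p \<theta>) / sqrt (1 - (across p \<theta>)\<^sup>2)) (at \<theta>)"
    using across_lt_1[OF assms, of \<theta>]
    by (auto intro!: derivative_eq_intros DERIV_across simp: divide_simps)
  have "- across p \<theta> + - (across p \<theta> * along p \<theta>) / sqrt (1 - (across p \<theta>)\<^sup>2) =
      - across p \<theta> * reach p \<theta> / sqrt (1 - (across p \<theta>)\<^sup>2)"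
    using across_lt_1(2)[OF assms, of \<theta>]
    by (simp add: reach_def divide_simps) (simp add: algebra_simps)
  thus ?thesis
    using DERIV_add[OF DERIV_along *, of p] by (simp add: reach_def[abs_def])
qed

lemma DERIV_swept:
  assumes "cmod p < 1/2"
  shows "(swept p has_real_derivative (reach p \<theta>)\<^sup>2) (at \<theta>)"
proof -
  define s where "s = sqrt (1 - (across p \<theta>)\<^sup>2)"
  have s: "s \<noteq> 0" "s\<^sup>2 = 1 - (across p \<theta>)\<^sup>2" using across_lt_1[OF assms, of \<theta>] by (auto simp: s_def)
  have r: "reach p \<theta> = along p \<theta> + s" by (simp add: reach_def s_def)
  have "reach p \<theta> / s + (along p \<theta> * reach p \<theta> +
      across p \<theta> * (- across p \<theta> * reach p \<theta> / s)) = (reach p \<theta>)\<^sup>2"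
    using s(1) unfolding r apply (simp add: field_simps) using s(2) by algebra
  thus ?thesis
    unfolding swept_def[abs_def] using DERIV_tilt[OF assms, of \<theta>] DERIV_reach[OF assms, of \<theta>]
    unfolding s_def[symmetric]
    by (auto intro!: derivative_eq_intros DERIV_across simp: algebra_simps)
qed

section \<open>Areas of sectors of disks\<close>

text \<open>Lebesgue measure on the plane is a product measure, so an integrand that splits into factors of one
coordinate each can be integrated factor by factor.\<close>

lemma has_integral_product_cart2:
  fixes f h :: "real \<Rightarrow> real"
  assumes [measurable]: "f \<in> borel_measurable borel" "h \<in> borel_measurable borel"
    and nonneg: "\<And>x. 0 \<le> f x" "\<And>x. 0 \<le> h x"
    and int: "(\<integral>\<^sup>+x. f x \<partial>lborel) = ennreal A" "(\<integral>\<^sup>+x. h x \<partial>lborel) = ennreal B" "0 \<le> A" "0 \<le> B"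
  shows "((\<lambda>w :: real^2. f (w $ 1) * h (w $ 2)) has_integral A * B) UNIV"
proof (rule nn_integral_has_integral)
  have B: "Basis = {axis 1 1, axis 2 1 :: real^2}"
    unfolding Basis_vec_def by (auto simp: exhaust_2) (metis exhaust_2)
  have ne: "axis 1 1 \<noteq> (axis 2 1 :: real^2)" by (simp add: axis_eq_axis)
  define k where "k = (\<lambda>b :: real^2. if b = axis 1 1 then f else h)"
  have [measurable]: "k b \<in> borel_measurable borel" for b by (simp add: k_def)
  have k0: "0 \<le> k b x" for b x using nonneg by (simp add: k_def)
  have "(\<integral>\<^sup>+w. ennreal (f (w $ 1) * h (w $ 2)) \<partial>(lborel :: (real^2) measure)) = (\<integral>\<^sup>+w. (\<Prod>b\<in>Basis. ennreal (k b (w \<bullet> b))) \<partial>lborel)"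
    using ne nonneg by (simp add: B k_def inner_axis ennreal_mult)
  also have "\<dots> = (\<Prod>b\<in>Basis. (\<integral>\<^sup>+x. k b x \<partial>lborel))"
    by (intro nn_integral_lborel_prod) auto
  also have "\<dots> = ennreal (A * B)" using ne int by (simp add: B k_def ennreal_mult)
  finally show "(\<integral>\<^sup>+w. ennreal (f (w $ 1) * h (w $ 2)) \<partial>(lborel :: (real^2) measure)) = ennreal (A * B)" .
  have [measurable]: "(\<lambda>w :: real^2. w $ i) \<in> borel_measurable borel" for i
    by (intro borel_measurable_continuous_onI continuous_intros)
  show "(\<lambda>w :: real^2. f (w $ 1) * h (w $ 2)) \<in> borel_measurable borel" by measurable
qed (use nonneg int in auto)

locale frame =
  fixes m e1 e2 :: "real^2"
  assumes unit1: "norm e1 = 1" and unit2: "norm e2 = 1" and orth: "e1 \<bullet> e2 = 0"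
begin

definition pt :: "complex \<Rightarrow> real^2" where
  "pt z = m + Re z *\<^sub>R e1 + Im z *\<^sub>R e2"

definition disk :: "complex \<Rightarrow> (real^2) set" where
  "disk p = unit_disk (pt p)"

definition cone :: "real \<Rightarrow> real \<Rightarrow> (real^2) set" where
  "cone \<alpha> \<beta> = {pt (rcis r \<theta>) | r \<theta>. 0 \<le> r \<and> \<alpha> \<le> \<theta> \<and> \<theta> \<le> \<beta>}"

lemma dist_pt: "dist (pt z) (pt w) = cmod (z - w)"
proof -
  define v where "v = Re (z - w) *\<^sub>R e1 + Im (z - w) *\<^sub>R e2"
  have "pt z - pt w = v"
    by (simp add: pt_def v_def algebra_simps)
  moreover have "v \<bullet> v = (Re (z - w))\<^sup>2 + (Im (z - w))\<^sup>2"
    using orth unit1 unit2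
    by (simp add: v_def inner_add_left inner_add_right norm_eq_1 inner_commute power2_eq_square)
  ultimately show ?thesis by (simp add: dist_norm norm_eq_sqrt_inner[of v] cmod_def)
qed

lemma inj_pt: "pt z = pt w \<longleftrightarrow> z = w"
  using dist_pt[of z w] by (metis dist_eq_0_iff eq_iff_diff_eq_0 norm_eq_zero)

lemma ray_in_disk_iff:
  assumes "cmod p < 1/2" "0 \<le> r"
  shows "pt (rcis r \<theta>) \<in> disk p \<longleftrightarrow> r \<le> reach p \<theta>"
  using rcis_in_disk_iff[OF assms, of \<theta>] dist_pt[of p "rcis r \<theta>"]
  by (simp add: disk_def unit_disk_def norm_minus_commute)

lemma det_frame: "\<bar>e1 $ 1 * e2 $ 2 - e1 $ 2 * e2 $ 1\<bar> = 1"
proof -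
  have "e1 $ 1 * e1 $ 1 + e1 $ 2 * e1 $ 2 = 1" "e2 $ 1 * e2 $ 1 + e2 $ 2 * e2 $ 2 = 1"
    "e1 $ 1 * e2 $ 1 + e1 $ 2 * e2 $ 2 = 0"
    using unit1 unit2 orth by (simp_all add: norm_eq_1 inner_vec_def sum_2)
  hence "(e1 $ 1 * e2 $ 2 - e1 $ 2 * e2 $ 1)\<^sup>2 = 1" by algebra
  thus ?thesis by (auto simp: power2_eq_1_iff)
qed

text \<open>Rescaling each ray by its exit distance turns a sector of a disk into a rectangle. The apex is the
image of a whole side, so it is left out to keep the map injective.\<close>

lemma sector_image:
  assumes p: "cmod p < 1/2" and "\<alpha> \<le> \<beta>" "\<beta> < \<alpha> + 2 * pi"
  defines "S \<equiv> {w :: real^2. 0 < w $ 1 \<and> w $ 1 \<le> 1 \<and> \<alpha> \<le> w $ 2 \<and> w $ 2 \<le> \<beta>}"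
    and "g \<equiv> \<lambda>w :: real^2. pt (rcis (w $ 1 * reach p (w $ 2)) (w $ 2))"
  shows "g ` S = disk p \<inter> cone \<alpha> \<beta> - {pt 0}" and "inj_on g S"
proof -
  show "g ` S = disk p \<inter> cone \<alpha> \<beta> - {pt 0}"
  proof (intro equalityI subsetI)
    fix x assume "x \<in> g ` S"
    then obtain w where w: "w \<in> S" and x: "x = pt (rcis (w $ 1 * reach p (w $ 2)) (w $ 2))"
      by (auto simp: g_def)
    have R: "0 < reach p (w $ 2)" using reach_pos[OF p] .
    have "0 < w $ 1 * reach p (w $ 2)" "w $ 1 * reach p (w $ 2) \<le> reach p (w $ 2)"
      using w R by (auto simp: S_def mult_le_cancel_right1)
    thus "x \<in> disk p \<inter> cone \<alpha> \<beta> - {pt 0}"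
      using w ray_in_disk_iff[OF p, of "w $ 1 * reach p (w $ 2)" "w $ 2"]
      unfolding x S_def cone_def by (auto simp: inj_pt) (metis less_imp_le)
  next
    fix x assume x: "x \<in> disk p \<inter> cone \<alpha> \<beta> - {pt 0}"
    then obtain r \<theta> where r: "x = pt (rcis r \<theta>)" "0 \<le> r" "\<alpha> \<le> \<theta>" "\<theta> \<le> \<beta>"
      by (auto simp: cone_def)
    have R: "0 < reach p \<theta>" using reach_pos[OF p] .
    have "r \<le> reach p \<theta>" using x r ray_in_disk_iff[OF p] by auto
    moreover have "r \<noteq> 0" using x r by auto
    ultimately have "vector [r / reach p \<theta>, \<theta>] \<in> S"
      using r R by (auto simp: S_def)
    moreover have "g (vector [r / reach p \<theta>, \<theta>]) = x" using r R by (simp add: g_def)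
    ultimately show "x \<in> g ` S" by blast
  qed
  show "inj_on g S"
  proof (rule inj_onI)
    fix v w assume v: "v \<in> S" and w: "w \<in> S" and eq: "g v = g w"
    define a b where "a = v $ 1 * reach p (v $ 2)" and "b = w $ 1 * reach p (w $ 2)"
    have pos: "0 < a" "0 < b" using v w reach_pos[OF p] by (auto simp: a_def b_def S_def)
    have eq': "rcis a (v $ 2) = rcis b (w $ 2)"
      using eq by (simp add: g_def inj_pt a_def b_def)
    hence "cmod (rcis a (v $ 2)) = cmod (rcis b (w $ 2))" by simp
    hence ab: "a = b" using pos by simp
    hence "cis (v $ 2) = cis (w $ 2)" using eq' pos by (simp add: rcis_def)
    hence "sin (v $ 2) = sin (w $ 2) \<and> cos (v $ 2) = cos (w $ 2)" by (simp add: complex_eq_iff)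
    then obtain n :: int where n: "v $ 2 = w $ 2 + 2 * pi * n"
      by (auto simp: sin_cos_eq_iff)
    have "\<bar>v $ 2 - w $ 2\<bar> < 2 * pi" using v w assms(3) by (auto simp: S_def)
    hence "\<bar>real_of_int n\<bar> < 1" using n by (simp add: abs_mult)
    hence "n = 0" by linarith
    hence 2: "v $ 2 = w $ 2" using n by simp
    moreover have "v $ 1 = w $ 1" using ab 2 reach_pos[OF p, of "w $ 2"] by (simp add: a_def b_def)
    ultimately show "v = w" by (simp add: vec_eq_iff forall_2)
  qed
qed

text \<open>The derivative of the exit distance contributes a multiple of the radial column only, so it disappears
from the determinant, which is therefore a product of a function of \<open>t\<close> and a function of \<open>\<theta>\<close>.\<close>

lemma sector_jacobian:
  fixes w :: "real^2"
  assumes p: "cmod p < 1/2"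
  shows "\<exists>g'. ((\<lambda>w :: real^2. pt (rcis (w $ 1 * reach p (w $ 2)) (w $ 2))) has_derivative g') (at w within S)
    \<and> \<bar>det (matrix g')\<bar> = \<bar>w $ 1\<bar> * (reach p (w $ 2))\<^sup>2"
proof -
  define R where "R = reach p (w $ 2)"
  obtain R' where "(reach p has_real_derivative R') (at (w $ 2))" using DERIV_reach[OF p] by blast
  hence R': "(reach p has_derivative (\<lambda>h. R' * h)) (at (w $ 2))"
    by (simp add: has_field_derivative_def)
  have c2: "((\<lambda>w :: real^2. w $ 2) has_derivative (\<lambda>h. h $ 2)) (at w within S)"
    by (rule bounded_linear_imp_has_derivative) (rule bounded_linear_vec_nth)
  have c1: "((\<lambda>w :: real^2. w $ 1) has_derivative (\<lambda>h. h $ 1)) (at w within S)"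
    by (rule bounded_linear_imp_has_derivative) (rule bounded_linear_vec_nth)
  have cR: "((\<lambda>w :: real^2. reach p (w $ 2)) has_derivative (\<lambda>h. R' * h $ 2)) (at w within S)"
    using has_derivative_compose[OF c2 R'] .
  define g' where "g' = (\<lambda>h :: real^2.
      (h $ 1 * R * cos (w $ 2) + w $ 1 * (R' * cos (w $ 2) - R * sin (w $ 2)) * h $ 2) *\<^sub>R e1 +
      (h $ 1 * R * sin (w $ 2) + w $ 1 * (R' * sin (w $ 2) + R * cos (w $ 2)) * h $ 2) *\<^sub>R e2)"
  have "((\<lambda>w :: real^2. pt (rcis (w $ 1 * reach p (w $ 2)) (w $ 2))) has_derivative g') (at w within S)"
    unfolding pt_def g'_def R_def
    by (auto intro!: derivative_eq_intros c1 c2 cR ext simp: algebra_simps)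
  moreover have "\<bar>det (matrix g')\<bar> = \<bar>w $ 1\<bar> * R\<^sup>2"
  proof -
    \<comment> \<open>the columns of the Jacobian in the frame; the frame itself contributes a factor of absolute value one\<close>
    define a b c d where "a = R * cos (w $ 2)" and "b = w $ 1 * (R' * cos (w $ 2) - R * sin (w $ 2))"
      and "c = R * sin (w $ 2)" and "d = w $ 1 * (R' * sin (w $ 2) + R * cos (w $ 2))"
    have "g' = (\<lambda>h. (h $ 1 * a + b * h $ 2) *\<^sub>R e1 + (h $ 1 * c + d * h $ 2) *\<^sub>R e2)"
      by (simp add: g'_def a_def b_def c_def d_def mult.assoc)
    hence "det (matrix g') = (a * d - b * c) * (e1 $ 1 * e2 $ 2 - e1 $ 2 * e2 $ 1)"
      by (simp add: det_2 matrix_def axis_def algebra_simps)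
    also have "a * d - b * c = w $ 1 * R\<^sup>2 * ((sin (w $ 2))\<^sup>2 + (cos (w $ 2))\<^sup>2)"
      unfolding a_def b_def c_def d_def by algebra
    finally have "det (matrix g') = w $ 1 * R\<^sup>2 * (e1 $ 1 * e2 $ 2 - e1 $ 2 * e2 $ 1)"
      by simp
    thus ?thesis using det_frame by (simp add: abs_mult)
  qed
  ultimately show ?thesis by (auto simp: R_def)
qed

lemma sector_measure:
  assumes p: "cmod p < 1/2" and "\<alpha> \<le> \<beta>" "\<beta> < \<alpha> + 2 * pi"
  shows "disk p \<inter> cone \<alpha> \<beta> \<in> lmeasurable"
    and "measure lebesgue (disk p \<inter> cone \<alpha> \<beta>) = (swept p \<beta> - swept p \<alpha>) / 2"
proof -
  define S where "S = {w :: real^2. 0 < w $ 1 \<and> w $ 1 \<le> 1 \<and> \<alpha> \<le> w $ 2 \<and> w $ 2 \<le> \<beta>}"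
  define g where "g = (\<lambda>w :: real^2. pt (rcis (w $ 1 * reach p (w $ 2)) (w $ 2)))"
  define m where "m = (swept p \<beta> - swept p \<alpha>) / 2"
  have meas_reach[measurable]: "reach p \<in> borel_measurable borel"
    unfolding reach_def[abs_def] along_def across_def by measurable
  have "\<forall>w. \<exists>g'. (g has_derivative g') (at w within S)
      \<and> \<bar>det (matrix g')\<bar> = \<bar>w $ 1\<bar> * (reach p (w $ 2))\<^sup>2"
    unfolding g_def by (intro allI sector_jacobian[OF p])
  then obtain g' where "\<forall>w. (g has_derivative g' w) (at w within S)
      \<and> \<bar>det (matrix (g' w))\<bar> = \<bar>w $ 1\<bar> * (reach p (w $ 2))\<^sup>2"
    using choice[of "\<lambda>w g'. (g has_derivative g') (at w within S)
      \<and> \<bar>det (matrix g')\<bar> = \<bar>w $ 1\<bar> * (reach p (w $ 2))\<^sup>2"] by blast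
  hence g': "\<And>w. (g has_derivative g' w) (at w within S)"
      "\<And>w. \<bar>det (matrix (g' w))\<bar> = \<bar>w $ 1\<bar> * (reach p (w $ 2))\<^sup>2" by auto
  have S_borel: "S \<in> sets borel"
  proof -
    have "S = {w. 0 < w $ 1} \<inter> {w. w $ 1 \<le> 1} \<inter> ({w. \<alpha> \<le> w $ 2} \<inter> {w. w $ 2 \<le> \<beta>})"
      by (auto simp: S_def)
    thus ?thesis by (auto intro!: borel_open borel_closed sets.Int
        open_halfspace_component_gt_cart closed_halfspace_component_le_cart closed_halfspace_component_ge_cart)
  qed
  have "((\<lambda>w. \<bar>w $ 1\<bar> * (reach p (w $ 2))\<^sup>2) has_integral m) S"
  proof -
    define f h where "f = (\<lambda>t. t * indicat_real {0..1} t)"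
      and "h = (\<lambda>\<theta>. (reach p \<theta>)\<^sup>2 * indicat_real {\<alpha>..\<beta>} \<theta>)"
    have "(\<integral>\<^sup>+t. ennreal t * indicator {0..1} t \<partial>lborel) = ennreal (1\<^sup>2 / 2 - 0\<^sup>2 / 2)"
      by (rule nn_integral_FTC_Icc) (auto intro!: derivative_eq_intros)
    moreover have "(\<integral>\<^sup>+t. f t \<partial>lborel) = (\<integral>\<^sup>+t. ennreal t * indicator {0..1} t \<partial>lborel)"
      by (intro nn_integral_cong) (auto simp: f_def indicator_def)
    ultimately have f: "(\<integral>\<^sup>+t. f t \<partial>lborel) = ennreal (1/2)" by simp
    have "(\<integral>\<^sup>+\<theta>. ennreal ((reach p \<theta>)\<^sup>2) * indicator {\<alpha>..\<beta>} \<theta> \<partial>lborel) = ennreal (swept p \<beta> - swept p \<alpha>)"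
      using \<open>\<alpha> \<le> \<beta>\<close> by (intro nn_integral_FTC_Icc DERIV_swept[OF p]) auto
    moreover have "(\<integral>\<^sup>+t. h t \<partial>lborel) = (\<integral>\<^sup>+\<theta>. ennreal ((reach p \<theta>)\<^sup>2) * indicator {\<alpha>..\<beta>} \<theta> \<partial>lborel)"
      by (intro nn_integral_cong) (auto simp: h_def indicator_def)
    ultimately have h: "(\<integral>\<^sup>+t. h t \<partial>lborel) = ennreal (swept p \<beta> - swept p \<alpha>)" by simp
    have "swept p \<alpha> \<le> swept p \<beta>"
      by (rule DERIV_nonneg_imp_nondecreasing[OF \<open>\<alpha> \<le> \<beta>\<close>])
        (blast intro: DERIV_swept[OF p] zero_le_power2)
    hence "((\<lambda>w :: real^2. f (w $ 1) * h (w $ 2)) has_integral 1/2 * (swept p \<beta> - swept p \<alpha>)) UNIV"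
      using f h by (intro has_integral_product_cart2) (auto simp: f_def h_def indicator_def)
    moreover have "(\<lambda>w. f (w $ 1) * h (w $ 2)) =
        (\<lambda>w. if w \<in> S then \<bar>w $ 1\<bar> * (reach p (w $ 2))\<^sup>2 else 0)"
      by (auto simp: f_def h_def S_def indicator_def fun_eq_iff)
    ultimately show ?thesis by (simp add: has_integral_restrict_UNIV m_def)
  qed
  hence "((\<lambda>w. \<bar>det (matrix (g' w))\<bar>) has_integral m) S" by (simp add: g'(2))
  hence *: "g ` S \<in> lmeasurable \<and> measure lebesgue (g ` S) = m"
    using has_measure_differentiable_image[of S g g' m] g'(1) S_borel
      sector_image(2)[OF assms] unfolding S_def[symmetric] g_def[symmetric] by auto
  have img: "g ` S = disk p \<inter> cone \<alpha> \<beta> - {pt 0}"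
    using sector_image(1)[OF assms] by (simp add: S_def g_def)
  have "pt 0 = pt (rcis 0 \<alpha>)" by simp
  hence "pt 0 \<in> cone \<alpha> \<beta>" unfolding cone_def using \<open>\<alpha> \<le> \<beta>\<close> by blast
  hence "pt 0 \<in> disk p \<inter> cone \<alpha> \<beta>"
    using ray_in_disk_iff[OF p, of 0 \<alpha>] reach_pos[OF p, of \<alpha>] by simp
  hence eq: "disk p \<inter> cone \<alpha> \<beta> = g ` S \<union> {pt 0}" using img by auto
  have null: "negligible {pt 0}" by simp
  hence "g ` S \<union> {pt 0} \<in> lmeasurable"
    using * negligible_imp_measurable by (intro fmeasurable.Un) auto
  moreover have "measure lebesgue (g ` S \<union> {pt 0}) = m"
    using * null measure_Un_null_set[of "g ` S" lebesgue "{pt 0}"]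
    by (auto simp: negligible_iff_null_sets)
  ultimately have "disk p \<inter> cone \<alpha> \<beta> \<in> lmeasurable \<and> measure lebesgue (disk p \<inter> cone \<alpha> \<beta>) = m"
    unfolding eq by blast
  thus "disk p \<inter> cone \<alpha> \<beta> \<in> lmeasurable"
    and "measure lebesgue (disk p \<inter> cone \<alpha> \<beta>) = (swept p \<beta> - swept p \<alpha>) / 2"
    by (auto simp: m_def)
qed

end

section \<open>Symmetric differences of two disks\<close>

text \<open>Twice \<open>half_lune (d / 2)\<close> is the area by which two unit disks with centres at distance \<open>d\<close> differ on one
side, that is, the area of one of the two lunes between them.\<close>

definition half_lune :: "real \<Rightarrow> real" where
  "half_lune s = s * sqrt (1 - s\<^sup>2) + arcsin s"

text \<open>Seen from \<open>p\<close> the exit point lies on the unit circle, so comparisons of two disks along a ray become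
comparisons of a single cosine.\<close>

lemma boundary_point:
  assumes "cmod p < 1/2"
  shows "rcis (reach p \<theta>) \<theta> = p + cis (tilt p \<theta>)"
proof -
  define s where "s = sqrt (1 - (across p \<theta>)\<^sup>2)"
  have a: "\<bar>across p \<theta>\<bar> < 1" using across_lt_1(1)[OF assms] .
  have tilt: "cos (tilt p \<theta>) = cos \<theta> * s - sin \<theta> * across p \<theta>"
    "sin (tilt p \<theta>) = sin \<theta> * s + cos \<theta> * across p \<theta>"
    using a by (auto simp: tilt_def cos_add sin_add s_def cos_arcsin)
  have p: "Re p = along p \<theta> * cos \<theta> + across p \<theta> * sin \<theta>"
    "Im p = along p \<theta> * sin \<theta> - across p \<theta> * cos \<theta>"
    using sin_cos_squared_add[of \<theta>] unfolding along_def across_def by algebra+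
  show ?thesis
    unfolding complex_eq_iff using tilt p
    by (simp add: reach_def s_def[symmetric] algebra_simps)
qed

text \<open>The exit point of disk \<open>p\<close> lies in disk \<open>q\<close> iff it is on the side of \<open>q\<close> of the perpendicular bisector
of \<open>p\<close> and \<open>q\<close>, which is at distance \<open>d / 2\<close> from \<open>p\<close> in the direction \<open>\<nu>\<close>.\<close>

lemma reach_le_iff_tilt:
  assumes p: "cmod p < 1/2" and q: "cmod q < 1/2" and pq: "q - p = rcis d \<nu>" and "0 < d"
  shows "reach p \<theta> \<le> reach q \<theta> \<longleftrightarrow> d / 2 \<le> cos (tilt p \<theta> - \<nu>)"
proof -
  have "reach p \<theta> \<le> reach q \<theta> \<longleftrightarrow> cmod (rcis (reach p \<theta>) \<theta> - q) \<le> 1"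
    using rcis_in_disk_iff[OF q less_imp_le[OF reach_pos[OF p]]] by simp
  also have "rcis (reach p \<theta>) \<theta> - q = cis (tilt p \<theta>) - rcis d \<nu>"
    using pq by (simp add: boundary_point[OF p] algebra_simps)
  also have "cmod \<dots> \<le> 1 \<longleftrightarrow> (cmod (cis (tilt p \<theta>) - rcis d \<nu>))\<^sup>2 \<le> 1"
    by (simp add: power_le_one_iff abs_square_le_1)
  also have "(cmod (cis (tilt p \<theta>) - rcis d \<nu>))\<^sup>2 =
      ((sin (tilt p \<theta>))\<^sup>2 + (cos (tilt p \<theta>))\<^sup>2) - 2 * d * cos (tilt p \<theta> - \<nu>)
      + d\<^sup>2 * ((sin \<nu>)\<^sup>2 + (cos \<nu>)\<^sup>2)"
    unfolding cmod_power2 cos_diff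
    by (simp only: minus_complex.simps cis.simps Re_rcis Im_rcis) algebra
  also have "\<dots> \<le> 1 \<longleftrightarrow> d * d \<le> d * (2 * cos (tilt p \<theta> - \<nu>))"
    by (simp add: power2_eq_square algebra_simps)
  also have "\<dots> \<longleftrightarrow> d / 2 \<le> cos (tilt p \<theta> - \<nu>)"
    using \<open>0 < d\<close> by (simp add: mult_le_cancel_left_pos) linarith
  finally show ?thesis .
qed

lemma tilt_mono:
  assumes "cmod p < 1/2" "\<alpha> \<le> \<beta>"
  shows "tilt p \<alpha> \<le> tilt p \<beta>"
  by (rule DERIV_nonneg_imp_nondecreasing[OF assms(2)])
    (use DERIV_tilt[OF assms(1)] reach_pos[OF assms(1)] across_lt_1[OF assms(1)] in
      \<open>meson divide_nonneg_nonneg less_imp_le real_sqrt_ge_zero diff_ge_0_iff_ge\<close>)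

lemma tilt_bounds:
  assumes "cmod p < 1/2"
  shows "\<theta> - pi / 6 \<le> tilt p \<theta>" "tilt p \<theta> \<le> \<theta> + pi / 6"
proof -
  have a: "\<bar>across p \<theta>\<bar> \<le> 1/2" using across_le[of p \<theta>] assms by simp
  have "arcsin (1/2) = pi / 6"
    by (rule arcsin_unique) (auto simp: sin_30)
  moreover have "arcsin (across p \<theta>) \<le> arcsin (1/2)" "arcsin (- (1/2)) \<le> arcsin (across p \<theta>)"
    using a arcsin_le_arcsin[of "across p \<theta>" "1/2"] arcsin_le_arcsin[of "- (1/2)" "across p \<theta>"]
    by linarith+
  moreover have "arcsin (- (1/2)) = - arcsin (1/2)" by (rule arcsin_minus) auto
  ultimately show "\<theta> - pi / 6 \<le> tilt p \<theta>" "tilt p \<theta> \<le> \<theta> + pi / 6"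
    unfolding tilt_def by linarith+
qed

lemma isCont_reach: "isCont (reach p) \<theta>" if "cmod p < 1/2"
  using DERIV_reach[OF that] DERIV_isCont by blast

text \<open>Because \<open>tilt\<close> is monotone and stays in a half turn on which \<open>cos (\<cdot> - \<nu>)\<close> increases, the two boundaries
cross only once. At the crossing both exit points coincide and form an isosceles triangle with \<open>p\<close> and
\<open>q\<close>, with legs \<open>1\<close> and base \<open>d\<close>, whose angles determine both tilts. Hence the difference of the
antiderivatives there has a closed form that does not involve the crossing angle \<open>\<gamma>\<close> itself.\<close>

lemma crossing:
  assumes p: "cmod p < 1/2" and q: "cmod q < 1/2" and pq: "q - p = rcis d \<nu>" and "0 < d"
    and "\<alpha> \<le> \<beta>" "\<nu> - 5 * pi / 6 \<le> \<alpha>" "\<beta> \<le> \<nu> - pi / 6"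
    and start: "reach q \<alpha> \<le> reach p \<alpha>" and stop: "reach p \<beta> \<le> reach q \<beta>"
  obtains \<gamma> where "\<alpha> \<le> \<gamma>" "\<gamma> \<le> \<beta>"
    "\<And>\<theta>. \<alpha> \<le> \<theta> \<Longrightarrow> \<theta> \<le> \<gamma> \<Longrightarrow> reach q \<theta> \<le> reach p \<theta>"
    "\<And>\<theta>. \<gamma> \<le> \<theta> \<Longrightarrow> \<theta> \<le> \<beta> \<Longrightarrow> reach p \<theta> \<le> reach q \<theta>"
    "swept p \<gamma> - swept q \<gamma> = 2 * half_lune (d / 2) + (Re p * Im q - Im p * Re q)"
proof -
  have "\<exists>\<gamma>\<ge>\<alpha>. \<gamma> \<le> \<beta> \<and> reach q \<gamma> - reach p \<gamma> = 0"
    using start stop \<open>\<alpha> \<le> \<beta>\<close>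
    by (intro IVT) (auto intro!: continuous_intros isCont_reach p q)
  then obtain \<gamma> where \<gamma>: "\<alpha> \<le> \<gamma>" "\<gamma> \<le> \<beta>" and eq: "reach p \<gamma> = reach q \<gamma>" by auto
  define a b where "a = tilt p \<gamma> - \<nu>" and "b = tilt q \<gamma> - \<nu>"
  have range: "- pi \<le> tilt x \<theta> - \<nu>" "tilt x \<theta> - \<nu> \<le> 0"
    if "cmod x < 1/2" "\<alpha> \<le> \<theta>" "\<theta> \<le> \<beta>" for x \<theta>
    using tilt_bounds[OF that(1), of \<theta>] that assms by auto
  have ab: "- pi \<le> a" "a \<le> 0" "- pi \<le> b" "b \<le> 0"
    using range p q \<gamma> by (auto simp: a_def b_def)
  have "p + cis (tilt p \<gamma>) = q + cis (tilt q \<gamma>)"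
    using boundary_point[OF p, of \<gamma>] boundary_point[OF q, of \<gamma>] eq by simp
  hence "cis (tilt p \<gamma>) = rcis d \<nu> + cis (tilt q \<gamma>)" using pq by (simp add: algebra_simps)
  \<comment> \<open>turn the picture so that the segment from \<open>p\<close> to \<open>q\<close> becomes horizontal\<close>
  hence "cis (tilt p \<gamma>) * cis (- \<nu>) = (rcis d \<nu> + cis (tilt q \<gamma>)) * cis (- \<nu>)" by simp
  hence "cis a = of_real d + cis b"
    by (simp add: a_def b_def cis_mult rcis_def ring_distribs mult.assoc)
  hence cs: "cos a = d + cos b" "sin a = sin b" by (auto simp: complex_eq_iff)
  hence "d * (d - 2 * cos a) = 0"
    using sin_cos_squared_add[of a] sin_cos_squared_add[of b] by algebra
  hence cosa: "cos a = d / 2" using \<open>0 < d\<close> by simp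
  hence cosb: "cos b = - (d / 2)" using cs by simp
  have "reach q \<theta> \<le> reach p \<theta>" if "\<alpha> \<le> \<theta>" "\<theta> \<le> \<gamma>" for \<theta>
  proof -
    have "cos (tilt q \<theta> - \<nu>) \<le> cos b"
      using range[OF q, of \<theta>] that \<gamma> ab tilt_mono[OF q, of \<theta> \<gamma>]
      by (intro cos_monotone_minus_pi_0') (auto simp: b_def)
    hence "d / 2 \<le> cos (tilt q \<theta> - (\<nu> + pi))" 
      using cosb by (simp add: cos_diff cos_add sin_add)
    moreover have "p - q = rcis d (\<nu> + pi)"
      using pq by (auto simp: complex_eq_iff cos_add sin_add)
    ultimately show ?thesis using reach_le_iff_tilt[OF q p] \<open>0 < d\<close> by blast
  qed
  moreover have "reach p \<theta> \<le> reach q \<theta>" if "\<gamma> \<le> \<theta>" "\<theta> \<le> \<beta>" for \<theta>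
  proof -
    have "cos a \<le> cos (tilt p \<theta> - \<nu>)"
      using range[OF p, of \<theta>] that \<gamma> ab tilt_mono[OF p, of \<gamma> \<theta>]
      by (intro cos_monotone_minus_pi_0') (auto simp: a_def)
    thus ?thesis using reach_le_iff_tilt[OF p q pq \<open>0 < d\<close>] cosa by simp
  qed
  moreover have "swept p \<gamma> - swept q \<gamma> = 2 * half_lune (d / 2) + (Re p * Im q - Im p * Re q)"
  proof -
    have d2: "d / 2 \<le> 1" using cosa cos_le_one[of a] by linarith
    have "arccos (cos (- a)) = - a" "arccos (cos (- b)) = - b"
      using ab arccos_cos[of "- a"] arccos_cos[of "- b"] by auto
    hence "arccos (d / 2) = - a" "arccos (- (d / 2)) = - b"
      unfolding cos_minus cosa cosb by auto
    moreover have "arccos (- (d / 2)) = pi - arccos (d / 2)"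
      using d2 \<open>0 < d\<close> by (intro arccos_minus) auto
    moreover have "arcsin (d / 2) = pi / 2 - arccos (d / 2)"
      using d2 \<open>0 < d\<close> by (intro arcsin_arccos_eq) auto
    ultimately have tilts: "tilt p \<gamma> - tilt q \<gamma> = 2 * arcsin (d / 2)"
      by (simp add: a_def b_def)
    have "sin a = - sqrt (1 - (d / 2)\<^sup>2)"
    proof -
      have "0 \<le> sin (- a)" using ab by (intro sin_ge_zero) auto
      hence "sin (- a) = sqrt (1 - (cos (- a))\<^sup>2)" by (intro sin_cos_sqrt)
      thus ?thesis using cosa by simp
    qed
    moreover have "reach p \<gamma> * sin (\<gamma> - \<nu>) = Im p * cos \<nu> - Re p * sin \<nu> + sin a"
    proof -
      have "rcis (reach p \<gamma>) \<gamma> * cis (- \<nu>) = (p + cis (tilt p \<gamma>)) * cis (- \<nu>)"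
        by (simp add: boundary_point[OF p])
      hence "Im (rcis (reach p \<gamma>) \<gamma> * cis (- \<nu>)) = Im ((p + cis (tilt p \<gamma>)) * cis (- \<nu>))"
        by simp
      thus ?thesis by (simp add: a_def sin_diff algebra_simps)
    qed
    moreover have "across p \<gamma> - across q \<gamma> = - d * sin (\<gamma> - \<nu>)"
    proof -
      have "Re q = Re p + d * cos \<nu>" "Im q = Im p + d * sin \<nu>"
        using pq by (auto simp: complex_eq_iff)
      thus ?thesis by (simp add: across_def sin_diff algebra_simps)
    qed
    moreover have "Re p * Im q - Im p * Re q = - d * (Im p * cos \<nu> - Re p * sin \<nu>)"
    proof -
      have "Re q = Re p + d * cos \<nu>" "Im q = Im p + d * sin \<nu>"
        using pq by (auto simp: complex_eq_iff)
      thus ?thesis by (simp add: algebra_simps)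
    qed
    moreover have "swept p \<gamma> - swept q \<gamma> =
        (tilt p \<gamma> - tilt q \<gamma>) + (across p \<gamma> - across q \<gamma>) * reach p \<gamma>"
      by (simp add: swept_def eq algebra_simps)
    ultimately show ?thesis
      unfolding tilts half_lune_def by (simp add: algebra_simps) (algebra)
  qed
  ultimately show thesis using \<gamma> that by blast
qed

context frame begin

text \<open>When one disk reaches farther on every ray, the parts of the two disks in the cone are nested and the
symmetric difference is a plain difference of sectors.\<close>

lemma sym_diff_measure_nested:
  assumes p: "cmod p < 1/2" and q: "cmod q < 1/2" and "\<alpha> \<le> \<beta>" "\<beta> < \<alpha> + 2 * pi"
    and le: "\<And>\<theta>. \<alpha> \<le> \<theta> \<Longrightarrow> \<theta> \<le> \<beta> \<Longrightarrow> reach q \<theta> \<le> reach p \<theta>"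
  shows "sym_diff (disk p) (disk q) \<inter> cone \<alpha> \<beta> \<in> lmeasurable"
    and "measure lebesgue (sym_diff (disk p) (disk q) \<inter> cone \<alpha> \<beta>) =
      ((swept p \<beta> - swept q \<beta>) - (swept p \<alpha> - swept q \<alpha>)) / 2"
proof -
  note P = sector_measure[OF p assms(3,4)] and Q = sector_measure[OF q assms(3,4)]
  have sub: "disk q \<inter> cone \<alpha> \<beta> \<subseteq> disk p \<inter> cone \<alpha> \<beta>"
  proof
    fix x assume x: "x \<in> disk q \<inter> cone \<alpha> \<beta>"
    then obtain r \<theta> where "x = pt (rcis r \<theta>)" "0 \<le> r" "\<alpha> \<le> \<theta>" "\<theta> \<le> \<beta>"
      by (auto simp: cone_def)
    thus "x \<in> disk p \<inter> cone \<alpha> \<beta>"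
      using x le[of \<theta>] ray_in_disk_iff[OF p, of r \<theta>] ray_in_disk_iff[OF q, of r \<theta>] by auto
  qed
  have eq: "sym_diff (disk p) (disk q) \<inter> cone \<alpha> \<beta> =
      (disk p \<inter> cone \<alpha> \<beta>) - (disk q \<inter> cone \<alpha> \<beta>)" using sub by auto
  show "sym_diff (disk p) (disk q) \<inter> cone \<alpha> \<beta> \<in> lmeasurable"
    unfolding eq using P Q by (intro fmeasurable.Diff)
  show "measure lebesgue (sym_diff (disk p) (disk q) \<inter> cone \<alpha> \<beta>) =
      ((swept p \<beta> - swept q \<beta>) - (swept p \<alpha> - swept q \<alpha>)) / 2"
    unfolding eq using measurable_measure_Diff[OF P(1) fmeasurableD[OF Q(1)] sub] P(2) Q(2)
    by (simp add: field_simps)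
qed

lemma cone_split: "cone \<alpha> \<beta> = cone \<alpha> \<gamma> \<union> cone \<gamma> \<beta>" if "\<alpha> \<le> \<gamma>" "\<gamma> \<le> \<beta>"
  using that unfolding cone_def by (auto; metis le_cases order_trans)

text \<open>Here the order of the disks changes once. Only the values at the ends of the cone and the closed form
at the crossing enter the bound.\<close>

lemma sym_diff_measure_crossing:
  assumes p: "cmod p < 1/2" and q: "cmod q < 1/2" and pq: "q - p = rcis d \<nu>" and "0 < d"
    and "\<alpha> \<le> \<beta>" "\<nu> - 5 * pi / 6 \<le> \<alpha>" "\<beta> \<le> \<nu> - pi / 6"
    and "reach q \<alpha> \<le> reach p \<alpha>" and "reach p \<beta> \<le> reach q \<beta>"
  shows "sym_diff (disk p) (disk q) \<inter> cone \<alpha> \<beta> \<in> lmeasurable"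
    and "measure lebesgue (sym_diff (disk p) (disk q) \<inter> cone \<alpha> \<beta>) \<le>
      2 * half_lune (d / 2) + (Re p * Im q - Im p * Re q)
      - ((swept p \<alpha> - swept q \<alpha>) + (swept p \<beta> - swept q \<beta>)) / 2"
proof -
  obtain \<gamma> where \<gamma>: "\<alpha> \<le> \<gamma>" "\<gamma> \<le> \<beta>"
    and 1: "\<And>\<theta>. \<alpha> \<le> \<theta> \<Longrightarrow> \<theta> \<le> \<gamma> \<Longrightarrow> reach q \<theta> \<le> reach p \<theta>"
    and 2: "\<And>\<theta>. \<gamma> \<le> \<theta> \<Longrightarrow> \<theta> \<le> \<beta> \<Longrightarrow> reach p \<theta> \<le> reach q \<theta>"
    and sw: "swept p \<gamma> - swept q \<gamma> = 2 * half_lune (d / 2) + (Re p * Im q - Im p * Re q)"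
    using crossing[OF assms] by blast
  have "\<beta> - \<alpha> < 2 * pi" using assms pi_gt_zero by linarith
  hence w: "\<gamma> < \<alpha> + 2 * pi" "\<beta> < \<gamma> + 2 * pi" using \<gamma> by auto
  note A = sym_diff_measure_nested[OF p q \<gamma>(1) w(1) 1]
    and B = sym_diff_measure_nested[OF q p \<gamma>(2) w(2) 2]
  have eq: "sym_diff (disk p) (disk q) \<inter> cone \<alpha> \<beta> =
    (sym_diff (disk p) (disk q) \<inter> cone \<alpha> \<gamma>) \<union> (sym_diff (disk q) (disk p) \<inter> cone \<gamma> \<beta>)"
    using cone_split[OF \<gamma>] by auto
  show "sym_diff (disk p) (disk q) \<inter> cone \<alpha> \<beta> \<in> lmeasurable"
    unfolding eq using A B by (intro fmeasurable.Un)
  have "measure lebesgue (sym_diff (disk p) (disk q) \<inter> cone \<alpha> \<beta>) \<le>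
      measure lebesgue (sym_diff (disk p) (disk q) \<inter> cone \<alpha> \<gamma>) +
      measure lebesgue (sym_diff (disk q) (disk p) \<inter> cone \<gamma> \<beta>)"
    unfolding eq using A B by (intro measure_Un_le fmeasurableD)
  thus "measure lebesgue (sym_diff (disk p) (disk q) \<inter> cone \<alpha> \<beta>) \<le>
      2 * half_lune (d / 2) + (Re p * Im q - Im p * Re q)
      - ((swept p \<alpha> - swept q \<alpha>) + (swept p \<beta> - swept q \<beta>)) / 2"
    using A(2) B(2) sw by (simp add: field_simps)
qed

end

lemma swept_eq:
  assumes "cmod p < 1/2"
  shows "swept p \<theta> = \<theta> + along p \<theta> * across p \<theta> + half_lune (across p \<theta>)"
  by (simp add: swept_def tilt_def reach_def half_lune_def algebra_simps)

text \<open>A form of the comparison that needs no angle between the centres; it settles the order of two disks on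
a ray whose direction is known explicitly.\<close>

lemma reach_le_iff_along:
  assumes p: "cmod p < 1/2" and q: "cmod q < 1/2"
  shows "reach p \<theta> \<le> reach q \<theta> \<longleftrightarrow>
    (cmod q)\<^sup>2 - (cmod p)\<^sup>2 \<le> 2 * reach p \<theta> * (along q \<theta> - along p \<theta>)"
proof -
  define r where "r = reach p \<theta>"
  have r: "(cmod (rcis r \<theta> - x))\<^sup>2 = r\<^sup>2 - 2 * r * along x \<theta> + (cmod x)\<^sup>2" for x
    using along_across[of x \<theta>] by (simp add: rcis_dist2 power2_diff)
  have "rcis r \<theta> - p = cis (tilt p \<theta>)" using boundary_point[OF p, of \<theta>] by (simp add: r_def)
  hence "(cmod (rcis r \<theta> - p))\<^sup>2 = 1" by simp
  hence 1: "r\<^sup>2 - 2 * r * along p \<theta> + (cmod p)\<^sup>2 = 1" unfolding r .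
  have "r \<le> reach q \<theta> \<longleftrightarrow> cmod (rcis r \<theta> - q) \<le> 1"
    using rcis_in_disk_iff[OF q, of r \<theta>] reach_pos[OF p, of \<theta>] by (simp add: r_def)
  also have "\<dots> \<longleftrightarrow> (cmod (rcis r \<theta> - q))\<^sup>2 \<le> 1"
    by (simp add: power_le_one_iff abs_square_le_1)
  also have "\<dots> \<longleftrightarrow> (cmod q)\<^sup>2 - (cmod p)\<^sup>2 \<le> 2 * r * (along q \<theta> - along p \<theta>)"
    using 1 unfolding r by (simp add: algebra_simps) linarith
  finally show ?thesis by (simp add: r_def)
qed

section \<open>Numerical estimates\<close>

lemma half_lune_minus: "\<bar>s\<bar> \<le> 1 \<Longrightarrow> half_lune (- s) = - half_lune s"
  by (simp add: half_lune_def arcsin_minus)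

lemma DERIV_half_lune:
  assumes "\<bar>s\<bar> < 1"
  shows "(half_lune has_real_derivative 2 * sqrt (1 - s\<^sup>2)) (at s)"
proof -
  define t where "t = sqrt (1 - s\<^sup>2)"
  have t: "t \<noteq> 0" "t\<^sup>2 = 1 - s\<^sup>2" 
  proof -
    have "s\<^sup>2 < 1" using assms by (simp add: abs_square_less_1)
    thus "t \<noteq> 0" "t\<^sup>2 = 1 - s\<^sup>2" by (auto simp: t_def)
  qed
  have "1 * t + s * ((0 - 2 * s) / (2 * t)) + 1 / t = 2 * t"
    using t by (simp add: field_simps power2_eq_square)
  moreover have "(half_lune has_real_derivative 1 * t + s * ((0 - 2 * s) / (2 * t)) + 1 / t) (at s)"
    unfolding half_lune_def[abs_def] t_def using assms abs_square_less_1[of s]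
    by (auto intro!: derivative_eq_intros simp: divide_simps)
  ultimately show ?thesis unfolding t_def by (rule back_subst[where P = "\<lambda>y. (half_lune has_real_derivative y) (at s)", rotated])
qed

lemma half_lune_mono: "half_lune s \<le> half_lune t" if "0 \<le> s" "s \<le> t" "t < 1"
proof (rule DERIV_nonneg_imp_nondecreasing[OF that(2)])
  fix x assume "s \<le> x" "x \<le> t"
  hence "\<bar>x\<bar> < 1" using that by auto
  thus "\<exists>y. (half_lune has_real_derivative y) (at x) \<and> 0 \<le> y"
    using DERIV_half_lune abs_square_less_1[of x] by (intro exI[of _ "2 * sqrt (1 - x\<^sup>2)"]) auto
qed

lemma half_lune_upper: "half_lune s \<le> 2 * s - s ^ 3 / 3" if "0 \<le> s" "s < 1"
proof -
  have "(\<lambda>x. 2 * x - x ^ 3 / 3 - half_lune x) 0 \<le> (\<lambda>x. 2 * x - x ^ 3 / 3 - half_lune x) s"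
  proof (rule DERIV_nonneg_imp_nondecreasing[OF that(1)])
    fix x assume x: "0 \<le> x" "x \<le> s"
    hence x1: "\<bar>x\<bar> < 1" using that by auto
    hence x2: "x\<^sup>2 < 1" by (simp add: abs_square_less_1)
    have "sqrt (1 - x\<^sup>2) \<le> 1 - x\<^sup>2 / 2"
      using x2 by (intro real_le_lsqrt) (auto simp: power2_eq_square algebra_simps x(1))
    moreover have "((\<lambda>x. 2 * x - x ^ 3 / 3 - half_lune x) has_real_derivative
        2 - x\<^sup>2 - 2 * sqrt (1 - x\<^sup>2)) (at x)"
      by (auto intro!: derivative_eq_intros DERIV_half_lune[OF x1])
    ultimately show "\<exists>y. ((\<lambda>x. 2 * x - x ^ 3 / 3 - half_lune x) has_real_derivative y) (at x) \<and> 0 \<le> y"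
      by (intro exI[of _ "2 - x\<^sup>2 - 2 * sqrt (1 - x\<^sup>2)"]) auto
  qed
  thus ?thesis by (simp add: half_lune_def)
qed

text \<open>The quintic Taylor coefficient is \<open>- 1 / 20\<close>; doubling it makes up for all later terms, which are
negative as well.\<close>

lemma half_lune_lower: "2 * s - s ^ 3 / 3 - s ^ 5 / 10 \<le> half_lune s" if "0 \<le> s" "s \<le> 1/2"
proof -
  have "(\<lambda>x. half_lune x - (2 * x - x ^ 3 / 3 - x ^ 5 / 10)) 0 \<le> (\<lambda>x. half_lune x - (2 * x - x ^ 3 / 3 - x ^ 5 / 10)) s"
  proof (rule DERIV_nonneg_imp_nondecreasing[OF that(1)])
    fix x assume x: "0 \<le> x" "x \<le> s"
    hence x1: "\<bar>x\<bar> < 1" using that by auto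
    have "x * x \<le> 1/2 * (1/2)" using x that by (intro mult_mono) auto
    hence u: "0 \<le> x\<^sup>2" "x\<^sup>2 \<le> 1/4" by (auto simp: power2_eq_square)
    define y where "y = x\<^sup>2"
    have "(1 - y / 2 - y\<^sup>2 / 4)\<^sup>2 = 1 - y - y\<^sup>2 * (1 / 4 - y / 4 - y\<^sup>2 / 16)"
      by (simp add: power2_eq_square algebra_simps)
    also have "\<dots> \<le> 1 - y"
    proof -
      have "y\<^sup>2 \<le> y * 1" unfolding power2_eq_square using u by (intro mult_left_mono) (auto simp: y_def)
      hence "0 \<le> 1 / 4 - y / 4 - y\<^sup>2 / 16" using u unfolding y_def by linarith
      thus ?thesis by simp
    qed
    finally have "1 - y / 2 - y\<^sup>2 / 4 \<le> sqrt (1 - x\<^sup>2)" unfolding y_def by (rule real_le_rsqrt)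
    moreover have "((\<lambda>x. half_lune x - (2 * x - x ^ 3 / 3 - x ^ 5 / 10)) has_real_derivative
        2 * sqrt (1 - x\<^sup>2) - (2 - x\<^sup>2 - x ^ 4 / 2)) (at x)"
      by (auto intro!: derivative_eq_intros DERIV_half_lune[OF x1])
    moreover have "y\<^sup>2 = x ^ 4" by (simp add: y_def)
    ultimately show "\<exists>z. ((\<lambda>x. half_lune x - (2 * x - x ^ 3 / 3 - x ^ 5 / 10)) has_real_derivative z) (at x) \<and> 0 \<le> z"
      by (intro exI[of _ "2 * sqrt (1 - x\<^sup>2) - (2 - x\<^sup>2 - x ^ 4 / 2)"]) (auto simp: y_def)
  qed
  thus ?thesis by (simp add: half_lune_def)
qed

text \<open>The circumradius of an equilateral triangle of side \<open>1 / 2\<close>.\<close>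

definition rad :: real where "rad = sqrt 3 / 6"

lemma rad_square: "rad\<^sup>2 = 1 / 12" "rad * rad = 1 / 12"
  by (simp_all add: rad_def power_divide)

lemma rad_bounds: "28/100 < rad" "rad < 29/100"
proof -
  have "0 \<le> rad" by (simp add: rad_def)
  thus "28/100 < rad" "rad < 29/100"
    using rad_square by (auto intro: power2_less_imp_less simp: power_divide)
qed

text \<open>The left side is twice the area bound of one sextant; its value is about \<open>1.0378\<close>, so the cubic and
quintic bounds of \<open>half_lune\<close> leave enough room.\<close>

lemma numeric_bound:
  "pi / 3 - rad / 8 - 4 * half_lune (1/4) + 8 * half_lune (1/8) + 4 * half_lune (rad/2) + 4 * half_lune (rad/4)
    - 2 * half_lune (3 * rad / 10 + 1/5) - 2 * half_lune ((3 * rad / 10 + 1/5) / 2)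
    - 3/2 * (3/20 - 2 * rad / 5) * (3 * rad / 10 + 1/5) \<le> 26/25"
proof -
  define R where "R = rad"
  have R2: "R\<^sup>2 = 1/12" and "0 \<le> R" using rad_square rad_bounds by (simp_all add: R_def)
  have R: "28867/100000 \<le> R" "R \<le> 28868/100000"
    using \<open>0 \<le> R\<close> R2 by (auto intro: power2_le_imp_le simp: power_divide)
  have R3: "R ^ 3 = R / 12" using R2 by (simp add: power3_eq_cube power2_eq_square mult.assoc)
  have "half_lune (R/2) \<le> 2 * (R/2) - (R/2) ^ 3 / 3" "half_lune (R/4) \<le> 2 * (R/4) - (R/4) ^ 3 / 3"
    using half_lune_upper[of "R/2"] half_lune_upper[of "R/4"] R by auto
  hence 1: "half_lune (R/2) \<le> R - R / 288" "half_lune (R/4) \<le> R / 2 - R / 2304"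
    by (auto simp: power_divide R3)
  have 2: "half_lune (1/8) \<le> 383/1536"
    using half_lune_upper[of "1/8"] by (simp add: power_numeral_reduce)
  have 3: "15197/30720 \<le> half_lune (1/4)"
    using half_lune_lower[of "1/4"] by (simp add: power_numeral_reduce)
  have "half_lune (2866/10000) \<le> half_lune (3 * R / 10 + 1/5)" "half_lune (1433/10000) \<le> half_lune ((3 * R / 10 + 1/5) / 2)"
    using R by (auto intro!: half_lune_mono)
  moreover have "2 * (2866/10000) - (2866/10000) ^ 3 / 3 - (2866/10000) ^ 5 / 10 \<le> half_lune (2866/10000)"
    "2 * (1433/10000) - (1433/10000) ^ 3 / 3 - (1433/10000) ^ 5 / 10 \<le> half_lune (1433/10000)"
    by (rule half_lune_lower; simp)+
  ultimately have 4: "565/1000 \<le> half_lune (3 * R / 10 + 1/5)" "2856/10000 \<le> half_lune ((3 * R / 10 + 1/5) / 2)"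
    by (auto simp: power_numeral_reduce)
  have 5: "(3/20 - 2 * R / 5) * (3 * R / 10 + 1/5) = 3/100 - 7 * R / 200 - 3/25 * R\<^sup>2"
    by (simp add: power2_eq_square algebra_simps)
  have "pi < 31416/10000" using pi_approx by simp
  thus ?thesis using 1 2 3 4 R unfolding R_def[symmetric] mult.assoc 5 R2
    by argo
qed

section \<open>The odd set in one sextant\<close>

text \<open>The centres in the frame whose origin is the centroid, whose first axis points to the vertex \<open>V0\<close> and
whose second axis is parallel to the opposite side. The point \<open>Mi\<close> is the midpoint of the side opposite
to \<open>Vi\<close>.\<close>

abbreviation "V0 \<equiv> Complex rad 0"
abbreviation "V1 \<equiv> Complex (- rad / 2) (1/4)"
abbreviation "V2 \<equiv> Complex (- rad / 2) (- 1/4)"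
abbreviation "M0 \<equiv> Complex (- rad / 2) 0"
abbreviation "M1 \<equiv> Complex (rad / 4) (- 1/8)"
abbreviation "M2 \<equiv> Complex (rad / 4) (1/8)"

lemma center_norms:
  "(cmod V0)\<^sup>2 = 1/12" "(cmod V1)\<^sup>2 = 1/12" "(cmod V2)\<^sup>2 = 1/12"
  "(cmod M0)\<^sup>2 = 1/48" "(cmod M1)\<^sup>2 = 1/48" "(cmod M2)\<^sup>2 = 1/48"
  by (simp_all add: cmod_power2 power_divide rad_square)

lemma cmod_vertex_lt: "(cmod z)\<^sup>2 = 1/12 \<Longrightarrow> cmod z < 1/2"
  by (rule power2_less_imp_less) (auto simp: power_divide)

lemma cmod_midpoint_lt: "(cmod z)\<^sup>2 = 1/48 \<Longrightarrow> cmod z < 3/20"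
  by (rule power2_less_imp_less) (auto simp: power_divide)

lemma centers_near:
  "cmod V0 < 1/2" "cmod V1 < 1/2" "cmod V2 < 1/2" "cmod M0 < 1/2" "cmod M1 < 1/2" "cmod M2 < 1/2"
  "cmod 0 < 1/2"
  using center_norms cmod_vertex_lt cmod_midpoint_lt[THEN less_trans, of _ "1/2"] by auto

lemma reach_0 [simp]: "reach 0 \<theta> = 1"
  by (simp add: reach_def along_def across_def)

lemma swept_0 [simp]: "swept 0 \<theta> = \<theta>"
  by (simp add: swept_def tilt_def across_def)

lemma reach_midpoint: "(cmod z)\<^sup>2 = 1/48 \<Longrightarrow> 7/10 < reach z \<theta>"
  using reach_ge[of z \<theta>] cmod_midpoint_lt[of z] by linarith

lemma sqrt3_rad: "sqrt 3 = 6 * rad" by (simp add: rad_def)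

text \<open>The best angle at which to exchange the partners of \<open>V1\<close> and \<open>M1\<close> is the direction where their
circles meet, about 34.2 degrees. The nearby angle of a 3-4-5 triangle has rational sine and cosine, and
since the loss is quadratic in the error it costs only about \<open>0.002\<close> in \<open>numeric_bound\<close>.\<close>

lemma swap_angle:
  fixes \<tau> :: real
  defines "\<tau> \<equiv> arcsin (3/5)"
  shows "0 \<le> \<tau>" "\<tau> \<le> pi / 3" "sin \<tau> = 3/5" "cos \<tau> = 4/5"
proof -
  have "(3/5)\<^sup>2 \<le> (sqrt 3 / 2)\<^sup>2" by (simp add: power_divide)
  hence "3/5 \<le> sqrt 3 / 2" by (rule power2_le_imp_le) simp
  hence "arcsin (3/5) \<le> arcsin (sin (pi / 3))"
    using sin_le_one[of "pi / 3"] by (intro arcsin_le_arcsin) (simp_all add: sin_60)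
  also have "\<dots> = pi / 3" using pi_gt_zero by (intro arcsin_sin) linarith+
  finally show "\<tau> \<le> pi / 3" by (simp add: \<tau>_def)
  show "0 \<le> \<tau>" using arcsin_le_arcsin[of 0 "3/5"] by (simp add: \<tau>_def)
  show "sin \<tau> = 3/5" by (simp add: \<tau>_def)
  have "sqrt (1 - (3/5)\<^sup>2) = sqrt ((4/5)\<^sup>2)" by (simp add: power_divide)
  thus "cos \<tau> = 4/5" by (simp add: \<tau>_def cos_arcsin)
qed

lemma measure_Un_le_add:
  assumes "A \<in> fmeasurable M" "measure M A \<le> x" "B \<in> fmeasurable M" "measure M B \<le> y"
  shows "measure M (A \<union> B) \<le> x + y"
  using measure_Un_le[of A M B] assms fmeasurableD[of A M] fmeasurableD[of B M] by linarith

context frame begin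

text \<open>The six disks other than \<open>V2\<close> are paired. A point in an odd number of disks that is not in \<open>V2\<close> lies in
exactly one disk of some pair, so the odd set is covered by \<open>V2\<close> and the symmetric differences of the
pairs. The pairs are chosen as neighbours in the order of exit distances (\<open>V2\<close> has the smallest), which
makes this cover nearly exact: the pairs \<open>M0, V1\<close> and \<open>M1, 0\<close> up to \<open>\<tau>\<close>, then \<open>M0, M1\<close> and \<open>0, V1\<close>, and
\<open>V0, M2\<close> throughout.\<close>

lemma sextant_cover:
  obtains U where "U \<in> lmeasurable" "measure lebesgue U \<le> 13/25"
    "{x. odd (size {# D \<in># image_mset disk {#V0, V1, V2, M2, M0, M1, 0#}. x \<in> D #})}
      \<inter> cone 0 (pi / 3) \<subseteq> U"
proof -
  define \<tau> where "\<tau> = arcsin (3/5)"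
  note \<tau> = swap_angle[folded \<tau>_def]
  have tau_lt: "pi / 3 < \<tau> + 2 * pi" using \<tau> pi_gt_zero by linarith
  have pi_lt: "pi / 3 < 0 + 2 * pi" using pi_gt_zero by linarith
  note near = centers_near and norms = center_norms
  have s60: "sin (pi / 3) = 3 * rad" "cos (pi / 3) = 1/2"
    by (simp_all add: sin_60 cos_60 sqrt3_rad)
  have s120: "sin (2 * pi / 3) = 3 * rad" "cos (2 * pi / 3) = - 1/2"
    by (simp_all add: sin_120 cos_120 sqrt3_rad)
  have s150: "sin (5 * pi / 6) = 1/2" "cos (5 * pi / 6) = - 3 * rad"
  proof -
    have "5 * pi / 6 = pi - pi / 6" by simp
    thus "sin (5 * pi / 6) = 1/2" "cos (5 * pi / 6) = - 3 * rad"
      by (simp_all only: sin_pi_minus cos_pi_minus sin_30 cos_30 sqrt3_rad)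
  qed
  note R = rad_bounds rad_square

  define A1 where "A1 = disk V2 \<inter> cone 0 (pi / 3)"
  define A2 where "A2 = sym_diff (disk M0) (disk V1) \<inter> cone 0 \<tau>"
  define A3 where "A3 = sym_diff (disk M1) (disk 0) \<inter> cone 0 \<tau>"
  define A4 where "A4 = sym_diff (disk M1) (disk M0) \<inter> cone \<tau> (pi / 3)"
  define A5 where "A5 = sym_diff (disk 0) (disk V1) \<inter> cone \<tau> (pi / 3)"
  define A6 where "A6 = sym_diff (disk V0) (disk M2) \<inter> cone 0 (pi / 3)"

  have A1: "A1 \<in> lmeasurable" "measure lebesgue A1 = (swept V2 (pi / 3) - swept V2 0) / 2"
    unfolding A1_def using sector_measure[OF near(3) _ pi_lt] by auto
  have A2: "A2 \<in> lmeasurable" "measure lebesgue A2 \<le> 2 * half_lune (1/8) - rad / 8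
      - ((swept M0 0 - swept V1 0) + (swept M0 \<tau> - swept V1 \<tau>)) / 2"
  proof -
    have pq: "V1 - M0 = rcis (1/4) (pi / 2)" by (simp add: complex_eq_iff)
    have start: "reach V1 0 \<le> reach M0 0"
      unfolding reach_le_iff_along[OF near(2,4)] norms by (simp add: along_def)
    have "5/96 < reach M0 \<tau> * (3/20)" using reach_midpoint[OF norms(4), of \<tau>] by simp
    hence stop: "reach M0 \<tau> \<le> reach V1 \<tau>"
      unfolding reach_le_iff_along[OF near(4,2)] norms by (simp add: along_def \<tau>)
    have "0 < (1/4::real)" "pi / 2 - 5 * pi / 6 \<le> 0" "\<tau> \<le> pi / 2 - pi / 6" using \<tau> by auto
    note S = sym_diff_measure_crossing[OF near(4,2) pq this(1) \<tau>(1) this(2,3) start stop]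
    thus "A2 \<in> lmeasurable" "measure lebesgue A2 \<le> 2 * half_lune (1/8) - rad / 8
      - ((swept M0 0 - swept V1 0) + (swept M0 \<tau> - swept V1 \<tau>)) / 2"
      unfolding A2_def by simp_all
  qed
  have A3: "A3 \<in> lmeasurable" "measure lebesgue A3 \<le> 2 * half_lune (rad / 4)
      - ((swept M1 0 - 0) + (swept M1 \<tau> - \<tau>)) / 2"
  proof -
    have pq: "0 - M1 = rcis (rad / 2) (2 * pi / 3)"
      by (simp add: complex_eq_iff s120 R)
    have start: "reach 0 0 \<le> reach M1 0"
      unfolding reach_le_iff_along[OF near(7,5)] norms using R by (simp add: along_def)
    have "reach M1 \<tau> * (rad / 5 - 3/40) \<le> 0"
      using R reach_pos[OF near(5), of \<tau>] by (intro mult_nonneg_nonpos) auto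
    hence stop: "reach M1 \<tau> \<le> reach 0 \<tau>"
      unfolding reach_le_iff_along[OF near(5,7)] norms by (simp add: along_def \<tau> algebra_simps)
    have "0 < rad / 2" "2 * pi / 3 - 5 * pi / 6 \<le> 0" "\<tau> \<le> 2 * pi / 3 - pi / 6" using \<tau> R by auto
    note S = sym_diff_measure_crossing[OF near(5,7) pq this(1) \<tau>(1) this(2,3) start stop]
    thus "A3 \<in> lmeasurable" "measure lebesgue A3 \<le> 2 * half_lune (rad / 4)
      - ((swept M1 0 - 0) + (swept M1 \<tau> - \<tau>)) / 2"
      unfolding A3_def by simp_all
  qed
  have A4: "A4 \<in> lmeasurable" "measure lebesgue A4 =
      ((swept M1 (pi / 3) - swept M0 (pi / 3)) - (swept M1 \<tau> - swept M0 \<tau>)) / 2"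
  proof -
    have "reach M0 \<theta> \<le> reach M1 \<theta>" if "\<tau> \<le> \<theta>" "\<theta> \<le> pi / 3" for \<theta>
    proof -
      have "0 \<le> sin (pi / 3 - \<theta>)" using that \<tau> by (intro sin_ge_zero) auto
      hence "0 \<le> 3 * rad * cos \<theta> - sin \<theta> / 2" by (simp add: sin_diff s60)
      hence "0 \<le> 2 * reach M0 \<theta> * (along M1 \<theta> - along M0 \<theta>)"
        using reach_pos[OF near(4), of \<theta>]
        by (intro mult_nonneg_nonneg) (auto simp: along_def)
      thus ?thesis unfolding reach_le_iff_along[OF near(4,5)] norms by simp
    qed
    from sym_diff_measure_nested[OF near(5,4) \<tau>(2) tau_lt this]
    show "A4 \<in> lmeasurable" "measure lebesgue A4 =
      ((swept M1 (pi / 3) - swept M0 (pi / 3)) - (swept M1 \<tau> - swept M0 \<tau>)) / 2"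
      unfolding A4_def by auto
  qed
  have A5: "A5 \<in> lmeasurable" "measure lebesgue A5 \<le> 2 * half_lune (rad / 2)
      - ((\<tau> - swept V1 \<tau>) + (pi / 3 - swept V1 (pi / 3))) / 2"
  proof -
    have pq: "V1 - 0 = rcis rad (2 * pi / 3)"
      by (simp add: complex_eq_iff s120 R)
    have "\<not> reach 0 \<tau> \<le> reach V1 \<tau>"
      unfolding reach_le_iff_along[OF near(7,2)] norms using R by (simp add: along_def \<tau>)
    hence start: "reach V1 \<tau> \<le> reach 0 \<tau>" by simp
    have stop: "reach 0 (pi / 3) \<le> reach V1 (pi / 3)"
      unfolding reach_le_iff_along[OF near(7,2)] norms using R by (simp add: along_def s60)
    have "0 < rad" "2 * pi / 3 - 5 * pi / 6 \<le> \<tau>" "pi / 3 \<le> 2 * pi / 3 - pi / 6" using \<tau> R by auto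
    note S = sym_diff_measure_crossing[OF near(7,2) pq this(1) \<tau>(2) this(2,3) start stop]
    thus "A5 \<in> lmeasurable" "measure lebesgue A5 \<le> 2 * half_lune (rad / 2)
      - ((\<tau> - swept V1 \<tau>) + (pi / 3 - swept V1 (pi / 3))) / 2"
      unfolding A5_def by simp_all
  qed
  have A6: "A6 \<in> lmeasurable" "measure lebesgue A6 \<le> 2 * half_lune (1/8) + rad / 8
      - ((swept V0 0 - swept M2 0) + (swept V0 (pi / 3) - swept M2 (pi / 3))) / 2"
  proof -
    have pq: "M2 - V0 = rcis (1/4) (5 * pi / 6)"
      by (simp add: complex_eq_iff s150)
    have "7/10 * (28/100) \<le> reach M2 0 * rad"
      using reach_midpoint[OF norms(6), of 0] R by (intro mult_mono) auto
    hence start: "reach M2 0 \<le> reach V0 0"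
      unfolding reach_le_iff_along[OF near(6,1)] norms by (simp add: along_def mult.commute)
    have stop: "reach V0 (pi / 3) \<le> reach M2 (pi / 3)"
      unfolding reach_le_iff_along[OF near(1,6)] norms by (simp add: along_def s60)
    have "0 < (1/4::real)" "5 * pi / 6 - 5 * pi / 6 \<le> 0" "pi / 3 \<le> 5 * pi / 6 - pi / 6" "0 \<le> pi / 3" by auto
    note S = sym_diff_measure_crossing[OF near(1,6) pq this(1,4,2,3) start stop]
    thus "A6 \<in> lmeasurable" "measure lebesgue A6 \<le> 2 * half_lune (1/8) + rad / 8
      - ((swept V0 0 - swept M2 0) + (swept V0 (pi / 3) - swept M2 (pi / 3))) / 2"
      unfolding A6_def by simp_all
  qed

  define U where "U = A1 \<union> A2 \<union> A3 \<union> A4 \<union> A5 \<union> A6"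
  have U: "U \<in> lmeasurable"
    unfolding U_def using A1 A2 A3 A4 A5 A6 by (intro fmeasurable.Un)
  have "measure lebesgue U \<le> measure lebesgue A1 + measure lebesgue A2 + measure lebesgue A3
      + measure lebesgue A4 + measure lebesgue A5 + measure lebesgue A6"
    unfolding U_def using A1(1) A2(1) A3(1) A4(1) A5(1) A6(1)
    by (intro measure_Un_le_add fmeasurable.Un order_refl)
  moreover have "2 * (measure lebesgue A1 + measure lebesgue A2 + measure lebesgue A3
      + measure lebesgue A4 + measure lebesgue A5 + measure lebesgue A6) \<le> 26/25"
  proof -
    have neg: "half_lune (- (1/4)) = - half_lune (1/4)" "half_lune (- (1/8)) = - half_lune (1/8)"
      by (simp_all add: half_lune_minus)
    have zero: "half_lune 0 = 0" by (simp add: half_lune_def)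
    note sw = near(1-6)[THEN swept_eq]
    have at_0: "swept V0 0 = 0" "swept V1 0 = rad / 8 - half_lune (1/4)"
      "swept V2 0 = - rad / 8 + half_lune (1/4)" "swept M0 0 = 0"
      "swept M1 0 = rad / 32 + half_lune (1/8)" "swept M2 0 = - rad / 32 - half_lune (1/8)"
      unfolding sw by (simp_all add: along_def across_def neg zero)
    have rr: "rad * (3 * rad) = 1/4" using R by simp
    have dir_60: "across V0 (pi / 3) = 1/4" "across V1 (pi / 3) = - (1/4)" "across V2 (pi / 3) = 0"
      "across M0 (pi / 3) = - (1/8)" "across M1 (pi / 3) = 1/8" "across M2 (pi / 3) = 0"
      "along V0 (pi / 3) = rad / 2" "along V1 (pi / 3) = rad / 2"
      "along M0 (pi / 3) = - rad / 4" "along M1 (pi / 3) = - rad / 4"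
      by (simp_all add: across_def along_def s60 rr)
    have at_60: "swept V0 (pi / 3) = pi / 3 + rad / 8 + half_lune (1/4)"
      "swept V1 (pi / 3) = pi / 3 - rad / 8 - half_lune (1/4)"
      "swept V2 (pi / 3) = pi / 3" "swept M0 (pi / 3) = pi / 3 + rad / 32 - half_lune (1/8)"
      "swept M1 (pi / 3) = pi / 3 - rad / 32 + half_lune (1/8)" "swept M2 (pi / 3) = pi / 3"
      unfolding sw dir_60 neg zero by simp_all
    have dir_\<tau>: "across V1 \<tau> = - (3 * rad / 10 + 1/5)" "across M1 \<tau> = (3 * rad / 10 + 1/5) / 2"
      "along V1 \<tau> = 3/20 - 2 * rad / 5" "along M1 \<tau> = - (3/20 - 2 * rad / 5) / 2"
      by (simp_all add: across_def along_def \<tau>)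
    have neg_\<tau>: "half_lune (- (3 * rad / 10 + 1/5)) = - half_lune (3 * rad / 10 + 1/5)"
      using R by (intro half_lune_minus) auto
    have at_\<tau>: "swept V1 \<tau> = \<tau> - (3/20 - 2 * rad / 5) * (3 * rad / 10 + 1/5) - half_lune (3 * rad / 10 + 1/5)"
      "swept M1 \<tau> = \<tau> - (3/20 - 2 * rad / 5) * (3 * rad / 10 + 1/5) / 4 + half_lune ((3 * rad / 10 + 1/5) / 2)"
    proof -
      have gen: "\<tau> + k * - A + - L = \<tau> - k * A - L" "\<tau> + - k / 2 * (A / 2) + L = \<tau> - k * A / 4 + L"
        for k A L :: real by simp_all
      show "swept V1 \<tau> = \<tau> - (3/20 - 2 * rad / 5) * (3 * rad / 10 + 1/5) - half_lune (3 * rad / 10 + 1/5)"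
        "swept M1 \<tau> = \<tau> - (3/20 - 2 * rad / 5) * (3 * rad / 10 + 1/5) / 4 + half_lune ((3 * rad / 10 + 1/5) / 2)"
        unfolding sw dir_\<tau> neg_\<tau> by (rule gen)+
    qed
    have "2 * (measure lebesgue A1 + measure lebesgue A2 + measure lebesgue A3
      + measure lebesgue A4 + measure lebesgue A5 + measure lebesgue A6) \<le>
      pi / 3 - rad / 8 - 4 * half_lune (1/4) + 8 * half_lune (1/8) + 4 * half_lune (rad / 2) + 4 * half_lune (rad / 4)
      - 2 * half_lune (3 * rad / 10 + 1/5) - 2 * half_lune ((3 * rad / 10 + 1/5) / 2)
      - 3/2 * (3/20 - 2 * rad / 5) * (3 * rad / 10 + 1/5)"
      using A1(2) A2(2) A3(2) A4(2) A5(2) A6(2)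
      unfolding at_0 at_60 at_\<tau> mult.assoc by argo
    also have "\<dots> \<le> 26/25" by (rule numeric_bound)
    finally show ?thesis .
  qed
  ultimately have "measure lebesgue U \<le> 13/25" by argo
  moreover have "{x. odd (size {# D \<in># image_mset disk {#V0, V1, V2, M2, M0, M1, 0#}. x \<in> D #})}
      \<inter> cone 0 (pi / 3) \<subseteq> U"
  proof (intro subsetI, elim IntE)
    fix x assume x: "x \<in> {x. odd (size {# D \<in># image_mset disk {#V0, V1, V2, M2, M0, M1, 0#}. x \<in> D #})}"
      and c: "x \<in> cone 0 (pi / 3)"
    show "x \<in> U"
    proof (rule ccontr)
      assume "x \<notin> U"
      hence "x \<notin> disk V2" "x \<in> disk V0 \<longleftrightarrow> x \<in> disk M2"
        using c unfolding U_def A1_def A6_def by blast+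
      moreover have "(x \<in> disk M0 \<longleftrightarrow> x \<in> disk V1) \<and> (x \<in> disk M1 \<longleftrightarrow> x \<in> disk 0) \<or>
          (x \<in> disk M1 \<longleftrightarrow> x \<in> disk M0) \<and> (x \<in> disk 0 \<longleftrightarrow> x \<in> disk V1)"
        using c \<open>x \<notin> U\<close> cone_split[OF \<tau>(1,2)]
        unfolding U_def A2_def A3_def A4_def A5_def by blast
      ultimately have "even (size {# D \<in># image_mset disk {#V0, V1, V2, M2, M0, M1, 0#}. x \<in> D #})"
        by auto
      thus False using x by simp
    qed
  qed
  ultimately show thesis using U that by blast
qed

end

section \<open>Six sextants cover the plane\<close>

lemma (in frame) pt_surj: "\<exists>z. x = pt z"
proof -
  define v where "v = x - m"
  define w where "w = v - (v \<bullet> e1) *\<^sub>R e1 - (v \<bullet> e2) *\<^sub>R e2"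
  have "w \<bullet> e1 = 0" "w \<bullet> e2 = 0"
    using unit1 unit2 orth by (simp_all add: w_def inner_diff_left inner_diff_right norm_eq_1 inner_commute)
  hence w: "w $ 1 * e1 $ 1 + w $ 2 * e1 $ 2 = 0" "w $ 1 * e2 $ 1 + w $ 2 * e2 $ 2 = 0"
    by (simp_all add: inner_vec_def sum_2)
  have d: "e1 $ 1 * e2 $ 2 - e1 $ 2 * e2 $ 1 \<noteq> 0" using det_frame by auto
  have "w $ 1 * (e1 $ 1 * e2 $ 2 - e1 $ 2 * e2 $ 1) = 0" "w $ 2 * (e1 $ 1 * e2 $ 2 - e1 $ 2 * e2 $ 1) = 0"
    using w by algebra+
  hence "w = 0" using d by (simp add: vec_eq_iff forall_2)
  hence "x = pt (Complex (v \<bullet> e1) (v \<bullet> e2))"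
    by (simp add: pt_def w_def v_def algebra_simps)
  thus ?thesis by blast
qed

text \<open>Both bisectors pass through the centroid; they bound the angle between the axis through \<open>V0\<close> and the
line through \<open>M2\<close>.\<close>

lemma (in frame) sextant_in_cone:
  assumes "dist x (pt V0) \<le> dist x (pt V1)" "dist x (pt V1) \<le> dist x (pt V2)"
  shows "x \<in> cone 0 (pi / 3)"
proof -
  obtain z where x: "x = pt z" using pt_surj by blast
  have "(cmod (z - V0))\<^sup>2 \<le> (cmod (z - V1))\<^sup>2" "(cmod (z - V1))\<^sup>2 \<le> (cmod (z - V2))\<^sup>2"
    using assms unfolding x dist_pt by (auto intro: power_mono)
  hence Im: "0 \<le> Im z" and Re: "Im z \<le> 6 * rad * Re z"
    using rad_square unfolding cmod_power2 by (auto simp: power2_eq_square algebra_simps)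
  have "0 \<le> rad * Re z" using Im Re by linarith
  hence "0 \<le> Re z" using rad_bounds by (auto simp: zero_le_mult_iff)
  show ?thesis
  proof (cases "z = 0")
    case True
    hence "x = pt (rcis 0 0)" by (simp add: x)
    thus ?thesis unfolding cone_def by fastforce
  next
    case False
    define r where "r = cmod z"
    have r: "0 < r" using False by (simp add: r_def)
    have "(Re z / r)\<^sup>2 + (Im z / r)\<^sup>2 = 1"
      using r by (simp add: power_divide add_divide_distrib[symmetric] r_def cmod_power2[symmetric])
    then obtain \<theta> where \<theta>: "0 \<le> \<theta>" "\<theta> \<le> pi / 2" "Re z / r = cos \<theta>" "Im z / r = sin \<theta>"
      using sincos_total_pi_half[of "Re z / r" "Im z / r"] \<open>0 \<le> Re z\<close> Im r by auto
    hence z: "Re z = r * cos \<theta>" "Im z = r * sin \<theta>" using r by (auto simp: field_simps)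
    have "\<theta> \<le> pi / 3"
    proof (rule ccontr)
      assume "\<not> \<theta> \<le> pi / 3"
      hence "0 < sin (\<theta> - pi / 3)" using \<theta> by (intro sin_gt_zero) auto
      hence "6 * rad * cos \<theta> < sin \<theta>" by (simp add: sin_diff sin_60 cos_60 sqrt3_rad mult_ac)
      hence "r * (6 * rad * cos \<theta>) < r * sin \<theta>" using r by simp
      thus False using Re unfolding z by (simp add: algebra_simps)
    qed
    moreover have "x = pt (rcis r \<theta>)" using z by (simp add: x inj_pt complex_eq_iff)
    ultimately show ?thesis using \<theta> r unfolding cone_def by fastforce
  qed
qed

definition odd_points :: "(real^2) set multiset \<Rightarrow> (real^2) set" where
  "odd_points F = {x. odd (size {# D \<in># F. x \<in> D #})}"

text \<open>Ordering the three vertices by their distance from a point selects a frame in which the point has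
polar angle between \<open>0\<close> and \<open>pi / 3\<close>, whichever orientation the triangle has. Stating the bound for the
set that this order describes lets it be applied to all six permutations of the vertices, instead of
moving measures by isometries.\<close>

lemma odd_sextant:
  assumes "equilateral_triangle (1/2) a b c"
  obtains U where "U \<in> lmeasurable" "measure lebesgue U \<le> 13/25"
    "{x \<in> odd_points (image_mset unit_disk (seven_centers a b c)). dist x a \<le> dist x b \<and> dist x b \<le> dist x c} \<subseteq> U"
proof -
  define m where "m = centroid a b c"
  define e1 where "e1 = (12 * rad) *\<^sub>R (a - m)"
  define e2 where "e2 = 2 *\<^sub>R (b - c)"
  define u v where "u = b - a" and "v = c - a"
  have n: "norm u = 1/2" "norm v = 1/2" "norm (u - v) = 1/2"
    using assms by (simp_all add: equilateral_triangle_def u_def v_def dist_norm norm_minus_commute)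
  have sq: "u \<bullet> u = 1/4" "v \<bullet> v = 1/4" "(u - v) \<bullet> (u - v) = 1/4"
    unfolding dot_square_norm n by (simp_all add: power_divide)
  have "u \<bullet> v = 1/8" using sq by (simp add: inner_diff_left inner_diff_right inner_commute)
  note ip = sq(1,2) this
  have m: "a - m = (- 1/3) *\<^sub>R (u + v)"
    by (simp add: m_def centroid_def u_def v_def vec_eq_iff field_simps)
  have bc: "b - c = u - v" by (simp add: u_def v_def)
  have "e1 \<bullet> e1 = 144 * (rad * rad) * ((a - m) \<bullet> (a - m))" by (simp add: e1_def)
  also have "\<dots> = 1"
    unfolding m rad_square using ip by (simp add: inner_add_left inner_add_right inner_commute)
  finally have n1: "norm e1 = 1" by (simp add: norm_eq_1)
  have n2: "norm e2 = 1" using \<open>norm (u - v) = 1/2\<close> by (simp add: e2_def bc)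
  have "e1 \<bullet> e2 = 0"
    unfolding e1_def e2_def m bc using ip
    by (simp add: inner_add_left inner_add_right inner_diff_left inner_diff_right inner_commute)
  then interpret frame m e1 e2 using n1 n2 by unfold_locales
  have e1: "rad *\<^sub>R e1 = a - m" by (simp add: e1_def rad_square mult.assoc[symmetric] mult.commute)
  have coords: "pt (Complex (k * rad) y) = m + k *\<^sub>R (a - m) + (2 * y) *\<^sub>R (b - c)" for k y
    unfolding pt_def e1[symmetric] by (simp add: e2_def)
  have "pt V0 = m + 1 *\<^sub>R (a - m) + 0 *\<^sub>R (b - c)"
    "pt V1 = m + (- 1/2) *\<^sub>R (a - m) + (1/2) *\<^sub>R (b - c)"
    "pt V2 = m + (- 1/2) *\<^sub>R (a - m) + (- 1/2) *\<^sub>R (b - c)"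
    "pt M0 = m + (- 1/2) *\<^sub>R (a - m) + 0 *\<^sub>R (b - c)"
    "pt M1 = m + (1/4) *\<^sub>R (a - m) + (- 1/4) *\<^sub>R (b - c)"
    "pt M2 = m + (1/4) *\<^sub>R (a - m) + (1/4) *\<^sub>R (b - c)"
    using coords[of 1 0] coords[of "-1/2" "1/4"] coords[of "-1/2" "-1/4"] coords[of "-1/2" 0]
      coords[of "1/4" "-1/8"] coords[of "1/4" "1/8"] by simp_all
  hence pts: "pt V0 = a" "pt V1 = b" "pt V2 = c" "pt M0 = midpoint b c" "pt M1 = midpoint c a"
      "pt M2 = midpoint a b"
    unfolding m_def centroid_def midpoint_def by (simp_all only:) (simp_all add: vec_eq_iff field_simps)
  have pt_0: "pt 0 = centroid a b c" unfolding m_def[symmetric] by (simp add: pt_def)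
  have F: "image_mset unit_disk (seven_centers a b c) = image_mset disk {#V0, V1, V2, M2, M0, M1, 0#}"
    by (simp only: seven_centers_def disk_def pts pt_0 image_mset_add_mset image_mset_empty)
  obtain U where U: "U \<in> lmeasurable" "measure lebesgue U \<le> 13/25"
    "odd_points (image_mset unit_disk (seven_centers a b c)) \<inter> cone 0 (pi / 3) \<subseteq> U"
    unfolding F odd_points_def using sextant_cover by blast
  moreover have "x \<in> cone 0 (pi / 3)" if "dist x a \<le> dist x b" "dist x b \<le> dist x c" for x
    using sextant_in_cone[of x] that unfolding pts by blast
  ultimately show thesis using that[OF U(1,2)] by blast
qed

theorem mainTheorem1:
  fixes a b c :: "real^2"
  assumes "equilateral_triangle (1/2) a b c"
  shows "odd_area (image_mset unit_disk (seven_centers a b c)) \<le> 3.12"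
proof -
  define S where "S = odd_points (image_mset unit_disk (seven_centers a b c))"
  define K where "K = (\<lambda>u v w :: real^2. {x \<in> S. dist x u \<le> dist x v \<and> dist x v \<le> dist x w})"
  have bound: "\<exists>U \<in> lmeasurable. measure lebesgue U \<le> 13/25 \<and> K u v w \<subseteq> U"
    if tri: "equilateral_triangle (1/2) u v w" and same: "seven_centers u v w = seven_centers a b c"
    for u v w
  proof -
    obtain U where "U \<in> lmeasurable" "measure lebesgue U \<le> 13/25"
      "{x \<in> odd_points (image_mset unit_disk (seven_centers u v w)). dist x u \<le> dist x v \<and> dist x v \<le> dist x w} \<subseteq> U"
      by (rule odd_sextant[OF tri])
    thus ?thesis unfolding same K_def S_def by blast
  qed
  have eqs: "equilateral_triangle (1/2) a b c" "equilateral_triangle (1/2) a c b"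
    "equilateral_triangle (1/2) b a c" "equilateral_triangle (1/2) b c a"
    "equilateral_triangle (1/2) c a b" "equilateral_triangle (1/2) c b a"
    using assms by (auto simp: equilateral_triangle_def dist_commute)
  have perms: "seven_centers a c b = seven_centers a b c" "seven_centers b a c = seven_centers a b c"
    "seven_centers b c a = seven_centers a b c" "seven_centers c a b = seven_centers a b c"
    "seven_centers c b a = seven_centers a b c"
    by (simp_all add: seven_centers_def centroid_def midpoint_sym add_ac add_mset_commute)
  obtain U1 where U1: "U1 \<in> lmeasurable" "measure lebesgue U1 \<le> 13/25" "K a b c \<subseteq> U1"
    using bound[OF eqs(1) refl] by blast
  obtain U2 where U2: "U2 \<in> lmeasurable" "measure lebesgue U2 \<le> 13/25" "K a c b \<subseteq> U2"
    using bound[OF eqs(2) perms(1)] by blast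
  obtain U3 where U3: "U3 \<in> lmeasurable" "measure lebesgue U3 \<le> 13/25" "K b a c \<subseteq> U3"
    using bound[OF eqs(3) perms(2)] by blast
  obtain U4 where U4: "U4 \<in> lmeasurable" "measure lebesgue U4 \<le> 13/25" "K b c a \<subseteq> U4"
    using bound[OF eqs(4) perms(3)] by blast
  obtain U5 where U5: "U5 \<in> lmeasurable" "measure lebesgue U5 \<le> 13/25" "K c a b \<subseteq> U5"
    using bound[OF eqs(5) perms(4)] by blast
  obtain U6 where U6: "U6 \<in> lmeasurable" "measure lebesgue U6 \<le> 13/25" "K c b a \<subseteq> U6"
    using bound[OF eqs(6) perms(5)] by blast
  define U where "U = U1 \<union> U2 \<union> U3 \<union> U4 \<union> U5 \<union> U6"
  have U: "U \<in> lmeasurable"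
    unfolding U_def using U1 U2 U3 U4 U5 U6 by (intro fmeasurable.Un)
  have "measure lebesgue U \<le> measure lebesgue U1 + measure lebesgue U2 + measure lebesgue U3
      + measure lebesgue U4 + measure lebesgue U5 + measure lebesgue U6"
    unfolding U_def using U1(1) U2(1) U3(1) U4(1) U5(1) U6(1)
    by (intro measure_Un_le_add fmeasurable.Un order_refl)
  hence mU: "measure lebesgue U \<le> 78/25" using U1(2) U2(2) U3(2) U4(2) U5(2) U6(2) by linarith
  have "S \<subseteq> K a b c \<union> K a c b \<union> K b a c \<union> K b c a \<union> K c a b \<union> K c b a"
    unfolding K_def by (intro subsetI) (simp, linarith)
  hence "S \<subseteq> U" unfolding U_def using U1(3) U2(3) U3(3) U4(3) U5(3) U6(3) by blast
  have "measure lebesgue S \<le> 78/25"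
  proof (cases "S \<in> sets lebesgue")
    case True
    thus ?thesis using measure_mono_fmeasurable[OF \<open>S \<subseteq> U\<close> True U] mU by linarith
    \<comment> \<open>a set that is not measurable has \<open>measure\<close> zero by convention\<close>
  qed (simp add: measure_notin_sets)
  thus ?thesis by (simp add: odd_area_def S_def odd_points_def)
qed

end
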